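(* Let $(A_0,A_1)$ be a quasi-Banach couple such that $A_0\cap A_1$ is not closed in $A_0+A_1$. If $0<\theta<1$, $\theta\neq 1/2$, and $0<p<\infty$, then $$(A_0,A_1)_{\theta,p}\neq (A_0,A_1)_{1-\theta,p}=(A_1,A_0)_{\theta,p}.$$ Moreover, if $0<\theta_0,\theta_1<1$, $\theta_0\neq\theta_1$, and $0<p,q<\infty$, then either $$(A_0,A_1)_{\theta_0,p}\neq (A_0,A_1)_{\theta_1,q}$$ or $$(A_1,A_0)_{\theta_0,p}\neq (A_1,A_0)_{\theta_1,q}.$$
   Context: A quasi-Banach couple $(A_0,A_1)$ consists of two quasi-Banach spaces (complete quasi-normed spaces) continuously embedded in a common Hausdorff topological vector space. For $x\in A_0+A_1$ and $t>0$, $K(x,t,A_0,A_1)=\inf\{\|a_0\|_{A_0}+t\|a_1\|_{A_1}: x=a_0+a_1,\ a_j\in A_j,\ j=0,1\}$. The sum carries the quasi-norm $\|x\|_{A_0+A_1}=K(x,1,A_0,A_1)$. For $0<\theta<1$ and $0<p<\infty$, $(A_0,A_1)_{\theta,p}$ is the space of all $x\in A_0+A_1$ with $\|x\|_{(A_0,A_1)_{\theta,p}}=\left(\int_0^\infty (t^{-\theta}K(x,t,A_0,A_1))^p\frac{dt}{t}\right)^{1/p}<\infty$; $(A_1,A_0)_{\theta,p}$ is defined in the same way with the roles of $A_0$ and $A_1$ exchanged. Equality of such spaces means equality as sets (the quasi-norms are then automatically equivalent). The "either ... or" is not exclusive. *)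

theory Defs
  imports "HOL-Analysis.Analysis" "HOL-Library.Set_Algebras"
begin

text \<open>
  A quasi-normed space is a linear subspace \<open>A\<close> of an ambient real vector space together with
  a function \<open>N\<close>, whose values outside \<open>A\<close> are irrelevant. Complex spaces are covered by
  restriction of scalars, which does not affect any of the notions below.
\<close>

definition quasi_normed_space :: "'v::real_vector set \<Rightarrow> ('v \<Rightarrow> real) \<Rightarrow> bool" where
  "quasi_normed_space A N \<longleftrightarrow>
     subspace A \<and>
     (\<forall>x\<in>A. 0 \<le> N x) \<and>
     (\<forall>x\<in>A. N x = 0 \<longleftrightarrow> x = 0) \<and>
     (\<forall>c. \<forall>x\<in>A. N (c *\<^sub>R x) = \<bar>c\<bar> * N x) \<and>
     (\<exists>C\<ge>1. \<forall>x\<in>A. \<forall>y\<in>A. N (x + y) \<le> C * (N x + N y))"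

definition quasi_Banach_space :: "'v::real_vector set \<Rightarrow> ('v \<Rightarrow> real) \<Rightarrow> bool" where
  "quasi_Banach_space A N \<longleftrightarrow>
     quasi_normed_space A N \<and>
     (\<forall>f :: nat \<Rightarrow> 'v.
        (\<forall>n. f n \<in> A) \<and> (\<forall>e>0. \<exists>M. \<forall>m\<ge>M. \<forall>n\<ge>M. N (f m - f n) < e)
        \<longrightarrow> (\<exists>x\<in>A. (\<lambda>n. N (f n - x)) \<longlonglongrightarrow> 0))"

text \<open>
  Quasi-norm balls need not be open in this topology, but if \<open>N\<close> is a quasi-norm on \<open>A\<close> then
  they form neighbourhood bases.
\<close>

definition quasi_norm_topology :: "'v::real_vector set \<Rightarrow> ('v \<Rightarrow> real) \<Rightarrow> 'v topology" where
  "quasi_norm_topology A N =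
     topology (\<lambda>U. U \<subseteq> A \<and> (\<forall>x\<in>U. \<exists>r>0. \<forall>y\<in>A. N (y - x) < r \<longrightarrow> y \<in> U))"

lemma openin_quasi_norm_topology:
  "openin (quasi_norm_topology A N) U \<longleftrightarrow>
     U \<subseteq> A \<and> (\<forall>x\<in>U. \<exists>r>0. \<forall>y\<in>A. N (y - x) < r \<longrightarrow> y \<in> U)"
proof -
  have "istopology (\<lambda>U. U \<subseteq> A \<and> (\<forall>x\<in>U. \<exists>r>0. \<forall>y\<in>A. N (y - x) < r \<longrightarrow> y \<in> U))"
    (is "istopology ?P")
    unfolding istopology_def
  proof (intro conjI allI impI)
    fix S T assume S: "?P S" and T: "?P T"
    show "S \<inter> T \<subseteq> A" using S by blast
    show "\<forall>x\<in>S \<inter> T. \<exists>r>0. \<forall>y\<in>A. N (y - x) < r \<longrightarrow> y \<in> S \<inter> T"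
    proof
      fix x assume "x \<in> S \<inter> T"
      then obtain r s where "r > 0" "\<forall>y\<in>A. N (y - x) < r \<longrightarrow> y \<in> S"
        and "s > 0" "\<forall>y\<in>A. N (y - x) < s \<longrightarrow> y \<in> T"
        using S T by blast
      then show "\<exists>r>0. \<forall>y\<in>A. N (y - x) < r \<longrightarrow> y \<in> S \<inter> T"
        by (intro exI[of _ "min r s"]) auto
    qed
  next
    fix \<K> assume "\<forall>K\<in>\<K>. ?P K"
    then show "\<Union>\<K> \<subseteq> A" and "\<forall>x\<in>\<Union>\<K>. \<exists>r>0. \<forall>y\<in>A. N (y - x) < r \<longrightarrow> y \<in> \<Union>\<K>"
      by (blast, meson Union_iff)
  qed
  then show ?thesis
    unfolding quasi_norm_topology_def by (simp add: topology_inverse')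
qed

lemma topspace_quasi_norm_topology: "topspace (quasi_norm_topology A N) = A"
proof
  show "topspace (quasi_norm_topology A N) \<subseteq> A"
    using openin_topspace[of "quasi_norm_topology A N"]
    by (simp only: openin_quasi_norm_topology)
  have "openin (quasi_norm_topology A N) A"
    unfolding openin_quasi_norm_topology by (auto intro: exI[of _ 1])
  then show "A \<subseteq> topspace (quasi_norm_topology A N)"
    by (rule openin_subset)
qed

definition Hausdorff_topological_vector_space :: "'v::real_vector topology \<Rightarrow> bool" where
  "Hausdorff_topological_vector_space T \<longleftrightarrow>
     topspace T = UNIV \<and> Hausdorff_space T \<and>
     continuous_map (prod_topology T T) T (\<lambda>(x, y). x + y) \<and>
     continuous_map (prod_topology euclideanreal T) T (\<lambda>(c, x). c *\<^sub>R x)"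

definition quasi_Banach_couple ::
    "'v::real_vector set \<Rightarrow> ('v \<Rightarrow> real) \<Rightarrow> 'v set \<Rightarrow> ('v \<Rightarrow> real) \<Rightarrow> bool" where
  "quasi_Banach_couple A0 N0 A1 N1 \<longleftrightarrow>
     quasi_Banach_space A0 N0 \<and> quasi_Banach_space A1 N1 \<and>
     (\<exists>T. Hausdorff_topological_vector_space T \<and>
          continuous_map (quasi_norm_topology A0 N0) T (\<lambda>x. x) \<and>
          continuous_map (quasi_norm_topology A1 N1) T (\<lambda>x. x))"

definition K_functional ::
    "'v::real_vector set \<Rightarrow> ('v \<Rightarrow> real) \<Rightarrow> 'v set \<Rightarrow> ('v \<Rightarrow> real) \<Rightarrow> 'v \<Rightarrow> real \<Rightarrow> real" where
  "K_functional A0 N0 A1 N1 x t =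
     Inf {N0 a0 + t * N1 a1 | a0 a1. a0 \<in> A0 \<and> a1 \<in> A1 \<and> x = a0 + a1}"

definition sum_quasi_norm ::
    "'v::real_vector set \<Rightarrow> ('v \<Rightarrow> real) \<Rightarrow> 'v set \<Rightarrow> ('v \<Rightarrow> real) \<Rightarrow> 'v \<Rightarrow> real" where
  "sum_quasi_norm A0 N0 A1 N1 x = K_functional A0 N0 A1 N1 x 1"

definition interpolation_quasi_norm ::
    "'v::real_vector set \<Rightarrow> ('v \<Rightarrow> real) \<Rightarrow> 'v set \<Rightarrow> ('v \<Rightarrow> real) \<Rightarrow> real \<Rightarrow> real \<Rightarrow> 'v \<Rightarrow> ennreal" where
  "interpolation_quasi_norm A0 N0 A1 N1 \<theta> p x =
     (let I = (\<integral>\<^sup>+t\<in>{0<..}. ennreal ((t powr (- \<theta>) * K_functional A0 N0 A1 N1 x t) powr p / t) \<partial>lborel)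
      in if I = \<infinity> then \<infinity> else ennreal (enn2real I powr (1 / p)))"

definition interpolation_space ::
    "'v::real_vector set \<Rightarrow> ('v \<Rightarrow> real) \<Rightarrow> 'v set \<Rightarrow> ('v \<Rightarrow> real) \<Rightarrow> real \<Rightarrow> real \<Rightarrow> 'v set" where
  "interpolation_space A0 N0 A1 N1 \<theta> p =
     {x \<in> A0 + A1. interpolation_quasi_norm A0 N0 A1 N1 \<theta> p x < \<infinity>}"

end

theory Submission
  imports Defs
begin

text \<open>
  Write \<open>s(a) = N0 a / N1 a\<close> for nonzero \<open>a \<in> A0 \<inter> A1\<close>. If \<open>A0 \<inter> A1\<close> is not closed in the sum, then
  \<open>s\<close> is not bounded away from both \<open>0\<close> and \<open>\<infinity>\<close>; by exchanging the two spaces, suppose that it is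
  unbounded above. Then there are elements with \<open>s(a)\<close> arbitrarily large and
  \<open>K(a, s(a)) \<ge> s(a)\<^sup>-\<^sup>\<gamma> N0 a\<close>, for any \<open>\<gamma> > 0\<close>: otherwise repeatedly discarding the \<open>A0\<close> part of
  a nearly optimal decomposition yields a sequence that converges in \<open>A0\<close>, tends to \<open>0\<close> in \<open>A1\<close>, and
  stays away from \<open>0\<close> in \<open>A0\<close>. For \<open>\<theta>0 < \<theta>' < \<theta>1\<close>, a gliding hump sum \<open>x \<in> A1\<close> of such elements,
  scaled to \<open>N0 a \<approx> s(a) powr \<theta>'\<close>, has \<open>K(x, t) = O(t powr \<theta>')\<close> but not \<open>K(x, t) = O(t powr \<theta>0)\<close>.
  So \<open>x\<close> belongs to every space with parameter \<open>\<theta>1\<close> and to none with parameter \<open>\<theta>0\<close>, which shows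
  that already the first alternative of the second claim always holds.
\<close>

section \<open>Weighted integrals over the half-line\<close>

text \<open>Translates finiteness of the integral into the notion for which the change of variables
  theorem is stated.\<close>

lemma nn_integral_finite_iff_absolutely_integrable:
  fixes h :: "real \<Rightarrow> real"
  assumes "A \<in> sets borel" "h \<in> borel_measurable (restrict_space borel A)" "\<And>t. t \<in> A \<Longrightarrow> 0 \<le> h t"
  shows "(\<integral>\<^sup>+t\<in>A. ennreal (h t) \<partial>lborel) < \<infinity> \<longleftrightarrow> h absolutely_integrable_on A"
proof -
  have meas: "(\<lambda>t. indicator A t *\<^sub>R h t) \<in> borel_measurable borel"
    using assms(1,2) by (simp add: borel_measurable_restrict_space_iff)
  have "h absolutely_integrable_on A \<longleftrightarrow> integrable lborel (\<lambda>t. indicator A t *\<^sub>R h t)"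
    using meas unfolding set_integrable_def by (simp add: integrable_completion)
  also have "\<dots> \<longleftrightarrow> (\<integral>\<^sup>+t. ennreal (norm (indicator A t *\<^sub>R h t)) \<partial>lborel) < \<infinity>"
    using meas by (simp add: integrable_iff_bounded)
  also have "(\<integral>\<^sup>+t. ennreal (norm (indicator A t *\<^sub>R h t)) \<partial>lborel) = (\<integral>\<^sup>+t\<in>A. ennreal (h t) \<partial>lborel)"
    by (intro nn_integral_cong) (auto simp: indicator_def assms(3))
  finally show ?thesis by simp
qed

text \<open>The measure \<open>dt/t\<close> is invariant under \<open>t\<close> to
  \<open>1/t\<close>. This is what exchanges the roles of the two spaces.\<close>

lemma nn_integral_finite_inversion:
  fixes h :: "real \<Rightarrow> real"
  assumes "h \<in> borel_measurable (restrict_space borel {0<..})" "\<And>t. t > 0 \<Longrightarrow> 0 \<le> h t"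
  shows "(\<integral>\<^sup>+t\<in>{0<..}. ennreal (h (1/t) / t) \<partial>lborel) < \<infinity> \<longleftrightarrow>
         (\<integral>\<^sup>+t\<in>{0<..}. ennreal (h t / t) \<partial>lborel) < \<infinity>"
proof -
  have meas_inv: "(\<lambda>t::real. 1/t) \<in> measurable (restrict_space borel {0<..}) (restrict_space borel {0<..})"
    by (intro measurable_restrict_space2 measurable_restrict_space1) (auto simp: space_restrict_space)
  have img: "(\<lambda>t. 1/t) ` {0<..} = {0::real<..}"
  proof (intro equalityI subsetI)
    fix t :: real assume "t \<in> {0<..}"
    then show "t \<in> (\<lambda>t. 1/t) ` {0<..}" by (intro image_eqI[of _ _ "1/t"]) auto
  qed auto
  have id: "(\<lambda>t::real. t) \<in> borel_measurable (restrict_space borel {0<..})"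
    by (intro measurable_restrict_space1) simp
  have "(\<integral>\<^sup>+t\<in>{0<..}. ennreal (h t / t) \<partial>lborel) < \<infinity> \<longleftrightarrow> (\<lambda>t. h t / t) absolutely_integrable_on {0<..}"
    by (rule nn_integral_finite_iff_absolutely_integrable) 
      (use assms id in \<open>auto intro!: borel_measurable_divide\<close>)
  also have "\<dots> \<longleftrightarrow> (\<lambda>t. h t / t) absolutely_integrable_on ((\<lambda>t. 1/t) ` {0<..})"
    by (simp only: img)
  \<comment> \<open>The Jacobian \<open>1/t^2\<close> and the division by \<open>1/t\<close> combine
    to the factor \<open>1/t\<close>.\<close>
  also have "\<dots> \<longleftrightarrow> (\<lambda>t. \<bar>- 1 / t^2\<bar> *\<^sub>R (h (1/t) / (1/t))) absolutely_integrable_on {0<..}"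
    by (rule absolutely_integrable_change_of_variables_real)
      (auto intro!: derivative_eq_intros simp: inj_on_def power2_eq_square)
  also have "\<dots> \<longleftrightarrow> (\<lambda>t. h (1/t) / t) absolutely_integrable_on {0<..}"
    by (intro set_integrable_cong) (auto simp: power2_eq_square)
  also have "\<dots> \<longleftrightarrow> (\<integral>\<^sup>+t\<in>{0<..}. ennreal (h (1/t) / t) \<partial>lborel) < \<infinity>"
    by (rule nn_integral_finite_iff_absolutely_integrable[symmetric])
      (use assms id measurable_compose[OF meas_inv assms(1)] in \<open>auto intro!: borel_measurable_divide\<close>)
  finally show ?thesis by simp
qed

text \<open>The linear bound makes the integrand summable near 0 because
  \<open>\<theta> < 1\<close>, and the bound with exponent \<theta>' makes it summable near infinity
  because \<open>\<theta>' < \<theta>\<close>. The resulting powers of \<open>t\<close> have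
  exponents \<open>\<alpha> > -1\<close> and \<open>\<beta> < -1\<close>.\<close>

lemma nn_integral_powr_finite:
  fixes f :: "real \<Rightarrow> real"
  assumes "\<theta>' < \<theta>" "\<theta> < 1" "0 < q"
    and nonneg: "\<And>t. t > 0 \<Longrightarrow> 0 \<le> f t"
    and small: "\<And>t. t > 0 \<Longrightarrow> f t \<le> B * t"
    and large: "\<And>t. t > 0 \<Longrightarrow> f t \<le> C * t powr \<theta>'"
  shows "(\<integral>\<^sup>+t\<in>{0<..}. ennreal ((t powr (-\<theta>) * f t) powr q / t) \<partial>lborel) < \<infinity>"
proof -
  define \<alpha> where "\<alpha> = (1 - \<theta>) * q - 1"
  define \<beta> where "\<beta> = (\<theta>' - \<theta>) * q - 1"
  have "\<alpha> > -1" "\<beta> < -1"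
    using assms(1-3) by (auto simp: \<alpha>_def \<beta>_def mult_less_0_iff)
  have BC: "B \<ge> 0" "C \<ge> 0"
    using nonneg[of 1] small[of 1] large[of 1] by auto
  have powers: "(t powr (-\<theta>) * (D * t powr a)) powr q / t = D powr q * t powr ((a - \<theta>) * q - 1)"
    if "t > 0" "D \<ge> 0" for t D a :: real
  proof -
    have "t powr (-\<theta>) * (D * t powr a) = D * t powr (a - \<theta>)"
      by (simp add: powr_diff powr_minus field_simps)
    then have "(t powr (-\<theta>) * (D * t powr a)) powr q / t = D powr q * (t powr ((a - \<theta>) * q) / t powr 1)"
      using that by (simp only:) (simp add: powr_mult powr_powr)
    then show ?thesis
      by (simp only: powr_diff)
  qed
  have "(\<integral>\<^sup>+t\<in>{0<..}. ennreal ((t powr (-\<theta>) * f t) powr q / t) \<partial>lborel) \<le>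
        (\<integral>\<^sup>+t. ennreal (B powr q) * (indicator {0..1} t * ennreal (t powr \<alpha>)) +
              ennreal (C powr q) * (indicator {1..} t * ennreal (t powr \<beta>)) \<partial>lborel)"
  proof (intro nn_integral_mono)
    fix t :: real
    consider "t \<le> 0" | "0 < t" "t \<le> 1" | "1 < t" by linarith
    then show "ennreal ((t powr (-\<theta>) * f t) powr q / t) * indicator {0<..} t \<le>
        ennreal (B powr q) * (indicator {0..1} t * ennreal (t powr \<alpha>)) +
        ennreal (C powr q) * (indicator {1..} t * ennreal (t powr \<beta>))"
    proof cases
      case 2
      have "(t powr (-\<theta>) * f t) powr q / t \<le> (t powr (-\<theta>) * (B * t)) powr q / t"
        using 2 assms(3) nonneg[of t] small[of t]
        by (intro divide_right_mono powr_mono2 mult_left_mono) auto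
      also have "\<dots> = B powr q * t powr \<alpha>"
        using powers[of t B 1] 2 BC by (simp add: \<alpha>_def)
      finally have "ennreal ((t powr (-\<theta>) * f t) powr q / t) \<le> ennreal (B powr q) * ennreal (t powr \<alpha>)"
        by (simp flip: ennreal_mult add: ennreal_leI)
      \<comment> \<open>At \<open>t = 1\<close> both indicators are 1, so the second summand has to
        be allowed for.\<close>
      also have "\<dots> \<le> \<dots> + x" for x by simp
      finally show ?thesis using 2 by auto
    next
      case 3
      have "(t powr (-\<theta>) * f t) powr q / t \<le> (t powr (-\<theta>) * (C * t powr \<theta>')) powr q / t"
        using 3 assms(3) nonneg[of t] large[of t]
        by (intro divide_right_mono powr_mono2 mult_left_mono) auto
      also have "\<dots> = C powr q * t powr \<beta>"
        using powers[of t C \<theta>'] 3 BC by (simp add: \<beta>_def)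
      finally have "ennreal ((t powr (-\<theta>) * f t) powr q / t) \<le> ennreal (C powr q) * ennreal (t powr \<beta>)"
        by (simp flip: ennreal_mult add: ennreal_leI)
      then show ?thesis using 3 by auto
    qed simp
  qed
  also have "\<dots> = ennreal (B powr q) * ennreal (1 powr (\<alpha> + 1) / (\<alpha> + 1)) +
                  ennreal (C powr q) * ennreal (- (1 powr (\<beta> + 1)) / (\<beta> + 1))"
    using nn_integral_has_integral_lebesgue[OF _ has_integral_powr_from_0[of \<alpha> 1]]
      nn_integral_has_integral_lebesgue[OF _ has_integral_powr_to_inf[of \<beta> 1]] \<open>\<alpha> > -1\<close> \<open>\<beta> < -1\<close>
    by (simp add: nn_integral_add nn_integral_cmult ennreal_mult ennreal_indicator)
  also have "\<dots> < \<infinity>"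
    by (simp add: ennreal_mult_less_top)
  finally show ?thesis .
qed

text \<open>For a monotone \<open>f\<close>, the part of the integral over \<open>{t..2*t}\<close>
  alone already controls \<open>f t\<close>.\<close>

lemma nn_integral_powr_finite_imp_bound:
  fixes f :: "real \<Rightarrow> real"
  assumes "0 < \<theta>" "0 < p"
    and nonneg: "\<And>t. t > 0 \<Longrightarrow> 0 \<le> f t"
    and mono: "\<And>s t. 0 < s \<Longrightarrow> s \<le> t \<Longrightarrow> f s \<le> f t"
    and fin: "(\<integral>\<^sup>+t\<in>{0<..}. ennreal ((t powr (-\<theta>) * f t) powr p / t) \<partial>lborel) < \<infinity>"
  shows "\<exists>C. \<forall>t>0. f t \<le> C * t powr \<theta>"
proof -
  obtain I where I: "(\<integral>\<^sup>+t\<in>{0<..}. ennreal ((t powr (-\<theta>) * f t) powr p / t) \<partial>lborel) = ennreal I" "I \<ge> 0"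
    using fin by (cases rule: ennreal_cases) auto
  have "f t \<le> (2 * I) powr (1/p) * 2 powr \<theta> * t powr \<theta>" if "t > 0" for t
  proof -
    \<comment> \<open>On \<open>{t..2*t}\<close> the decreasing weight is smallest at the right end
      and \<open>f\<close> at the left end, so \<open>v\<close> bounds their product from
      below.\<close>
    define v where "v = (2*t) powr (-\<theta>) * f t"
    have "v \<ge> 0" using nonneg[of t] that by (simp add: v_def)
    have "ennreal (v powr p / 2) = ennreal (v powr p / (2*t)) * emeasure lborel {t..2*t}"
      using that by (simp flip: ennreal_mult)
    also have "\<dots> = (\<integral>\<^sup>+u. ennreal (v powr p / (2*t)) * indicator {t..2*t} u \<partial>lborel)"
      by (simp add: nn_integral_cmult_indicator)
    also have "\<dots> \<le> (\<integral>\<^sup>+t\<in>{0<..}. ennreal ((t powr (-\<theta>) * f t) powr p / t) \<partial>lborel)"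
    proof (intro nn_integral_mono)
      fix u :: real
      show "ennreal (v powr p / (2*t)) * indicator {t..2*t} u \<le>
            ennreal ((u powr (-\<theta>) * f u) powr p / u) * indicator {0<..} u"
      proof (cases "u \<in> {t..2*t}")
        case True
        then have u: "t \<le> u" "u \<le> 2*t" "0 < u" using that by auto
        have "v \<le> u powr (-\<theta>) * f u"
          unfolding v_def using u assms(1) that nonneg
          by (intro mult_mono mono powr_mono2') auto
        then have "v powr p / (2*t) \<le> (u powr (-\<theta>) * f u) powr p / u"
          using u \<open>v \<ge> 0\<close> assms(2) by (intro frac_le powr_mono2) auto
        then show ?thesis using True u by (auto intro: ennreal_leI)
      qed auto
    qed
    finally have "v powr p \<le> 2 * I" using I by simp
    then have "(v powr p) powr (1/p) \<le> (2 * I) powr (1/p)"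
      using assms(2) by (intro powr_mono2) auto
    then have "v \<le> (2 * I) powr (1/p)"
      using assms(2) \<open>v \<ge> 0\<close> by (simp add: powr_powr)
    moreover have "f t = v * (2 powr \<theta> * t powr \<theta>)"
      using that by (simp add: v_def powr_minus powr_mult field_simps)
    ultimately show ?thesis
      by (simp add: mult.assoc mult_right_mono)
  qed
  then show ?thesis by blast
qed

section \<open>Quasi-normed spaces and couples\<close>

text \<open>The outer power \<open>1/p\<close> preserves finiteness, so membership can be tested on
  the integral itself.\<close>

lemma interpolation_space_iff:
  "x \<in> interpolation_space A0 N0 A1 N1 \<theta> p \<longleftrightarrow> x \<in> A0 + A1 \<and>
    (\<integral>\<^sup>+t\<in>{0<..}. ennreal ((t powr (-\<theta>) * K_functional A0 N0 A1 N1 x t) powr p / t) \<partial>lborel) < \<infinity>"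
    (is "_ \<longleftrightarrow> _ \<and> ?I < \<infinity>")
proof (cases "?I = \<infinity>")
  case False
  then have "?I < \<infinity>" by (metis infinity_ennreal_def top.not_eq_extremum)
  with False show ?thesis
    unfolding interpolation_space_def interpolation_quasi_norm_def Let_def by simp
qed (simp add: interpolation_space_def interpolation_quasi_norm_def Let_def)

text \<open>Kept general enough to have the K-functional at a fixed \<open>t\<close> as an instance,
  so that \<open>chain_bound\<close> serves \<open>N0\<close>, \<open>N1\<close> and
  \<open>K\<close> alike.\<close>

locale quasi_seminorm =
  fixes A :: "'v::real_vector set" and N :: "'v \<Rightarrow> real" and c :: real
  assumes subspace: "subspace A"
    and nonneg: "x \<in> A \<Longrightarrow> 0 \<le> N x"
    and zero: "N 0 = 0"
    and triangle: "x \<in> A \<Longrightarrow> y \<in> A \<Longrightarrow> N (x + y) \<le> c * (N x + N y)"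
    and one_le: "1 \<le> c"
begin

lemmas zero_mem = subspace_0[OF subspace]
lemmas add_mem = subspace_add[OF subspace]
lemmas diff_mem = subspace_diff[OF subspace]
lemmas neg_mem = subspace_neg[OF subspace]
lemmas scale_mem = subspace_scale[OF subspace]

lemma triangle_diff:
  assumes "x \<in> A" "y \<in> A" "z \<in> A"
  shows "N (x - z) \<le> c * (N (x - y) + N (y - z))"
  using triangle[of "x - y" "y - z"] assms by (simp add: diff_mem)

text \<open>The factor \<open>(2*c)^k\<close> absorbs the powers of \<open>c\<close> produced by iterating the quasi-triangle inequality.\<close>

lemma chain_bound:
  assumes "\<And>k. u k \<in> A" "0 \<le> D"
    and "\<And>k. k < n \<Longrightarrow> N (u (Suc k) - u k) \<le> D / (2*c)^k"
  shows "N (u n - u 0) \<le> 2 * c * D"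
  using assms
proof (induction n arbitrary: u D)
  case 0
  then show ?case using one_le zero by simp
next
  case (Suc n)
  \<comment> \<open>The induction hypothesis for the chain shifted by one, with
    \<open>D / (2*c)\<close>, gives the bound \<open>D\<close>; joining the first step costs
    \<open>c * (D + D)\<close>.\<close>
  have "N (u (Suc n) - u 1) \<le> 2 * c * (D / (2*c))"
    using Suc.IH[of "\<lambda>k. u (Suc k)" "D / (2*c)"] Suc.prems(1,2) Suc.prems(3)[of "Suc _"] one_le by simp
  moreover have "N (u 1 - u 0) \<le> D"
    using Suc.prems(3)[of 0] by simp
  ultimately have "c * (N (u (Suc n) - u 1) + N (u 1 - u 0)) \<le> c * (2 * D)"
    using one_le by (intro mult_left_mono) auto
  then show ?case
    using triangle_diff[of "u (Suc n)" "u 1" "u 0"] Suc.prems(1) by simp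
qed

end

locale quasi_banach = quasi_seminorm +
  assumes eq_zero: "x \<in> A \<Longrightarrow> N x = 0 \<Longrightarrow> x = 0"
    and scale: "x \<in> A \<Longrightarrow> N (r *\<^sub>R x) = \<bar>r\<bar> * N x"
    and complete: "(\<And>n. f n \<in> A) \<Longrightarrow> (\<And>e. e > 0 \<Longrightarrow> \<exists>M. \<forall>m\<ge>M. \<forall>n\<ge>M. N (f m - f n) < e) \<Longrightarrow>
      \<exists>x\<in>A. (\<lambda>n. N (f n - x)) \<longlonglongrightarrow> 0"
begin

lemma minus: "x \<in> A \<Longrightarrow> N (- x) = N x"
  using scale[of x "-1"] by simp

lemma commute: "x \<in> A \<Longrightarrow> y \<in> A \<Longrightarrow> N (x - y) = N (y - x)"
  using minus[of "x - y"] by (simp add: diff_mem)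

lemma pos: "x \<in> A \<Longrightarrow> x \<noteq> 0 \<Longrightarrow> 0 < N x"
  using nonneg eq_zero by force

text \<open>A quasi-norm need not be continuous, so a bound along the sequence survives in the limit
  only up to the factor \<open>c\<close>.\<close>

lemma limit_bound:
  assumes "\<And>n. u n \<in> A" "x \<in> A" "y \<in> A" "(\<lambda>n. N (u n - x)) \<longlonglongrightarrow> 0" "\<And>n. N (u n - y) \<le> B"
  shows "N (x - y) \<le> c * B"
proof (rule LIMSEQ_le_const)
  show "(\<lambda>n. c * (N (u n - x) + B)) \<longlonglongrightarrow> c * B"
    using assms(4) by (auto intro!: tendsto_eq_intros)
  have "N (x - y) \<le> c * (N (u n - x) + B)" for n
  proof -
    have "N (x - y) \<le> c * (N (u n - x) + N (u n - y))"
      using triangle_diff[of x "u n" y] assms(1-3) commute[of x "u n"] by simp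
    also have "\<dots> \<le> c * (N (u n - x) + B)"
      using one_le assms(5) by (intro mult_left_mono) auto
    finally show ?thesis .
  qed
  then show "\<exists>n0. \<forall>n\<ge>n0. N (x - y) \<le> c * (N (u n - x) + B)" by blast
qed

text \<open>Applying \<open>chain_bound\<close> to the tails shows that the sequence is
  Cauchy.\<close>

lemma geometric_increments_convergent:
  assumes u: "\<And>k. u k \<in> A" and "0 \<le> D" and incr: "\<And>k. N (u (Suc k) - u k) \<le> D / (2*c)^k"
  shows "\<exists>x\<in>A. (\<lambda>n. N (u n - x)) \<longlonglongrightarrow> 0"
proof (rule complete)
  fix e :: real assume "e > 0"
  \<comment> \<open>The constant arises from two tails of size \<open>2 * c * D / (2*c)^M\<close>,
    added at the cost of a factor \<open>c\<close>.\<close>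
  have "(\<lambda>n. (4 * c^2 * D) * (1 / (2*c))^n) \<longlonglongrightarrow> (4 * c^2 * D) * 0"
    using one_le by (intro tendsto_mult_left LIMSEQ_realpow_zero) auto
  then have "\<forall>\<^sub>F n in sequentially. (4 * c^2 * D) * (1 / (2*c))^n < e"
    using \<open>e > 0\<close> by (auto dest: order_tendstoD(2))
  then obtain M where M: "(4 * c^2 * D) * (1 / (2*c))^M < e"
    by (auto simp: eventually_sequentially)
  have tail: "N (u m - u M) \<le> 2 * c * (D / (2*c)^M)" if "m \<ge> M" for m
    using chain_bound[of "\<lambda>k. u (M + k)" "D / (2*c)^M" "m - M"] that u incr[of "M + _"] one_le \<open>0 \<le> D\<close>
    by (simp add: power_add mult.commute)
  have "N (u m - u n) < e" if "m \<ge> M" "n \<ge> M" for m n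
  proof -
    have "N (u m - u n) \<le> c * (N (u m - u M) + N (u n - u M))"
      using triangle_diff[of "u m" "u M" "u n"] commute[of "u M" "u n"] u by simp
    also have "\<dots> \<le> c * (2 * c * (D / (2*c)^M) + 2 * c * (D / (2*c)^M))"
      using one_le tail that by (intro mult_left_mono add_mono) auto
    also have "\<dots> < e"
      using M by (simp add: power2_eq_square power_divide algebra_simps)
    finally show ?thesis .
  qed
  then show "\<exists>M. \<forall>m\<ge>M. \<forall>n\<ge>M. N (u m - u n) < e" by blast
qed (rule u)

end

text \<open>Compatibility is all that the embedding into a common Hausdorff space is needed for.\<close>

locale quasi_couple =
  X0: quasi_banach A0 N0 c + X1: quasi_banach A1 N1 c
  for A0 A1 :: "'v::real_vector set" and N0 N1 :: "'v \<Rightarrow> real" and c :: real +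
  assumes compat: "(\<And>n. f n \<in> A0 \<inter> A1) \<Longrightarrow> x \<in> A0 \<Longrightarrow> y \<in> A1 \<Longrightarrow>
    (\<lambda>n. N0 (f n - x)) \<longlonglongrightarrow> 0 \<Longrightarrow> (\<lambda>n. N1 (f n - y)) \<longlonglongrightarrow> 0 \<Longrightarrow> x = y"
begin

abbreviation K :: "'v \<Rightarrow> real \<Rightarrow> real" where
  "K \<equiv> K_functional A0 N0 A1 N1"

lemma swap: "quasi_couple A1 A0 N1 N0 c"
  by unfold_locales (metis Int_commute compat)

lemma K_le:
  assumes "a \<in> A0" "b \<in> A1" "0 \<le> t"
  shows "K (a + b) t \<le> N0 a + t * N1 b"
  unfolding K_functional_def
proof (rule cInf_lower)
  show "bdd_below {N0 a0 + t * N1 a1 |a0 a1. a0 \<in> A0 \<and> a1 \<in> A1 \<and> a + b = a0 + a1}"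
    using assms(3) X0.nonneg X1.nonneg by (auto intro!: bdd_belowI[of _ 0])
qed (use assms in blast)

lemma K_greatest:
  assumes "x \<in> A0 + A1" "\<And>a b. a \<in> A0 \<Longrightarrow> b \<in> A1 \<Longrightarrow> x = a + b \<Longrightarrow> L \<le> N0 a + t * N1 b"
  shows "L \<le> K x t"
  unfolding K_functional_def
  using assms by (intro cInf_greatest) (auto elim!: set_plus_elim)

lemma K_lessE:
  assumes "x \<in> A0 + A1" "K x t < r"
  obtains a b where "a \<in> A0" "b \<in> A1" "x = a + b" "N0 a + t * N1 b < r"
  using K_greatest[OF assms(1), of r t] assms(2) by force

lemma K_nonneg: "x \<in> A0 + A1 \<Longrightarrow> 0 \<le> t \<Longrightarrow> 0 \<le> K x t"
  by (rule K_greatest) (auto intro!: add_nonneg_nonneg X0.nonneg mult_nonneg_nonneg X1.nonneg)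

lemma K_mono: "x \<in> A0 + A1 \<Longrightarrow> 0 \<le> s \<Longrightarrow> s \<le> t \<Longrightarrow> K x s \<le> K x t"
proof (rule K_greatest)
  fix a b assume "0 \<le> s" "s \<le> t" "a \<in> A0" "b \<in> A1" "x = a + b"
  then show "K x s \<le> N0 a + t * N1 b"
    using K_le[of a b s] X1.nonneg[of b] mult_right_mono[of s t "N1 b"] by simp
qed

lemma subspace_add_spaces: "subspace (A0 + A1)"
  using subspace_sums[OF X0.subspace X1.subspace] by (simp add: set_plus_def Bex_def conj_ac)

lemma A0_sum: "x \<in> A0 \<Longrightarrow> x \<in> A0 + A1"
  using set_plus_intro[of x A0 0 A1] X1.zero_mem by simp

lemma A1_sum: "x \<in> A1 \<Longrightarrow> x \<in> A0 + A1"
  using set_plus_intro[of 0 A0 x A1] X0.zero_mem by simp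

lemma K_le_N0: "x \<in> A0 \<Longrightarrow> 0 \<le> t \<Longrightarrow> K x t \<le> N0 x"
  using K_le[of x 0 t] X1.zero_mem X1.zero by simp

lemma K_le_N1: "x \<in> A1 \<Longrightarrow> 0 \<le> t \<Longrightarrow> K x t \<le> t * N1 x"
  using K_le[of 0 x t] X0.zero_mem X0.zero by simp

lemma K_triangle:
  assumes "x \<in> A0 + A1" "y \<in> A0 + A1" "0 \<le> t"
  shows "K (x + y) t \<le> c * (K x t + K y t)"
proof (rule field_le_epsilon)
  fix e :: real assume "e > 0"
  \<comment> \<open>Two nearly optimal decompositions, each off by \<open>d\<close>, contribute the
    error \<open>2 * c * d = e\<close> after the quasi-triangle inequality.\<close>
  define d where "d = e / (2 * c)"
  have "d > 0" using \<open>e > 0\<close> X0.one_le by (simp add: d_def)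
  obtain a b where ab: "a \<in> A0" "b \<in> A1" "x = a + b" "N0 a + t * N1 b < K x t + d"
    using K_lessE[OF assms(1), of t "K x t + d"] \<open>d > 0\<close> by auto
  obtain a' b' where ab': "a' \<in> A0" "b' \<in> A1" "y = a' + b'" "N0 a' + t * N1 b' < K y t + d"
    using K_lessE[OF assms(2), of t "K y t + d"] \<open>d > 0\<close> by auto
  have xy: "x + y = (a + a') + (b + b')" using ab ab' by simp
  have "K (x + y) t \<le> N0 (a + a') + t * N1 (b + b')"
    unfolding xy using ab ab' assms(3) by (intro K_le X0.add_mem X1.add_mem)
  also have "\<dots> \<le> c * (N0 a + N0 a') + t * (c * (N1 b + N1 b'))"
    using ab ab' assms(3) by (intro add_mono X0.triangle mult_left_mono X1.triangle)
  also have "\<dots> = c * ((N0 a + t * N1 b) + (N0 a' + t * N1 b'))"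
    by (simp add: algebra_simps)
  also have "\<dots> \<le> c * ((K x t + d) + (K y t + d))"
    using ab(4) ab'(4) X0.one_le by (intro mult_left_mono) linarith+
  also have "\<dots> = c * (K x t + K y t) + e"
    using X0.one_le by (simp add: d_def field_simps)
  finally show "K (x + y) t \<le> c * (K x t + K y t) + e" .
qed

lemma K_seminorm:
  assumes "0 \<le> t"
  shows "quasi_seminorm (A0 + A1) (\<lambda>x. K x t) c"
proof
  show "K 0 t = 0"
    using K_le_N0[of 0 t] K_nonneg[of 0 t] assms X0.zero_mem X0.zero A0_sum[of 0] by simp
qed (use assms subspace_add_spaces K_nonneg K_triangle X0.one_le in auto)

text \<open>Dividing a decomposition of \<open>r *\<^sub>R x\<close> by \<open>r\<close> gives one
  of \<open>x\<close>. This moves estimates of \<open>K\<close> between an element and its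
  normalisation.\<close>

lemma K_scale_ge:
  assumes "x \<in> A0 + A1" "0 < r" "0 \<le> t"
  shows "r * K x t \<le> K (r *\<^sub>R x) t"
proof (rule K_greatest)
  show "r *\<^sub>R x \<in> A0 + A1"
    using assms(1) subspace_scale[OF subspace_add_spaces] by blast
  fix a b assume ab: "a \<in> A0" "b \<in> A1" "r *\<^sub>R x = a + b"
  have "x = (1/r) *\<^sub>R (r *\<^sub>R x)" using assms(2) by simp
  also have "\<dots> = (1/r) *\<^sub>R a + (1/r) *\<^sub>R b" by (simp only: ab scaleR_add_right)
  finally have "K x t \<le> N0 ((1/r) *\<^sub>R a) + t * N1 ((1/r) *\<^sub>R b)"
    using K_le[of "(1/r) *\<^sub>R a" "(1/r) *\<^sub>R b" t] ab assms(3) X0.scale_mem X1.scale_mem by simp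
  also have "\<dots> = (N0 a + t * N1 b) / r"
    using ab assms(2) by (simp add: X0.scale X1.scale field_simps)
  finally show "r * K x t \<le> N0 a + t * N1 b"
    using assms(2) by (simp add: field_simps)
qed

text \<open>For a fixed decomposition the two costs agree, as
  \<open>N1 b + t * N0 a = t * (N0 a + (1/t) * N1 b)\<close>. The reverse inequality is this one for
  the exchanged couple at \<open>1/t\<close>.\<close>

lemma K_swap_le:
  assumes "x \<in> A0 + A1" "0 < t"
  shows "t * K x (1/t) \<le> K_functional A1 N1 A0 N0 x t"
proof -
  interpret S: quasi_couple A1 A0 N1 N0 c by (rule swap)
  show ?thesis
  proof (rule S.K_greatest)
    show "x \<in> A1 + A0" using assms(1) by (simp add: add.commute)
    fix b a assume ab: "b \<in> A1" "a \<in> A0" "x = b + a"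
    then have "K x (1/t) \<le> N0 a + (1/t) * N1 b"
      using K_le[of a b "1/t"] assms(2) by (simp add: add.commute)
    then show "t * K x (1/t) \<le> N1 b + t * N0 a"
      using assms(2) by (simp add: field_simps)
  qed
qed

lemma K_swap:
  assumes "x \<in> A0 + A1" "0 < t"
  shows "K_functional A1 N1 A0 N0 x t = t * K x (1/t)"
proof (rule antisym)
  interpret S: quasi_couple A1 A0 N1 N0 c by (rule swap)
  show "S.K x t \<le> t * K x (1/t)"
    using S.K_swap_le[of x "1/t"] assms by (simp add: add.commute field_simps)
qed (rule K_swap_le[OF assms])

section \<open>Elements whose K-functional decays slowly\<close>

text \<open>In a nearly optimal decomposition \<open>a = b + r\<close>, the part \<open>b\<close> is
  small in \<open>A0\<close>, so \<open>r\<close> keeps a fixed share of \<open>N0 a\<close>; the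
  cost of \<open>r\<close> forces \<open>N1 r \<le> \<eta> * N1 a\<close>. Hence the ratio of the
  quasi-norms grows by the factor \<open>M\<close>.\<close>

lemma split_step:
  assumes a: "a \<in> A0 \<inter> A1" "a \<noteq> 0" and s: "s = N0 a / N1 a"
    and K: "K a s < \<eta> * N0 a" and \<eta>: "\<eta> \<le> 1 / (4 * c * M)" and M: "c \<le> M"
  shows "\<exists>r\<in>A0 \<inter> A1. r \<noteq> 0 \<and> N0 (r - a) \<le> \<eta> * N0 a \<and> N0 r \<le> 2 * c * N0 a \<and>
    M * s \<le> N0 r / N1 r \<and> N1 r \<le> N1 a / 2"
proof -
  have c: "1 \<le> c" by (rule X0.one_le)
  have pos: "0 < N0 a" "0 < N1 a" using a X0.pos X1.pos by auto
  then have s_pos: "s > 0" by (simp add: s)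
  obtain b r where br: "b \<in> A0" "r \<in> A1" "a = b + r" "N0 b + s * N1 r < \<eta> * N0 a"
    using K_lessE[of a s] K A0_sum[of a] a by blast
  have r_eq: "r = a - b" using br by simp
  have r: "r \<in> A0 \<inter> A1"
    using X0.diff_mem[of a b] br(1,2) a(1) unfolding r_eq[symmetric] by blast
  have b_le: "N0 b \<le> \<eta> * N0 a"
    using br(4) mult_nonneg_nonneg[of s "N1 r"] X1.nonneg[OF br(2)] s_pos by linarith
  have "s * N1 r \<le> \<eta> * N0 a"
    using br(4) X0.nonneg[OF br(1)] by linarith
  also have "\<dots> = s * (\<eta> * N1 a)" using pos by (simp add: s)
  finally have N1r: "N1 r \<le> \<eta> * N1 a" using s_pos by simp
  \<comment> \<open>The first bound lets \<open>c * N0 b\<close> be absorbed into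
    \<open>N0 a\<close>; the second yields both the gain \<open>M\<close> in the ratio and the
    halving of \<open>N1\<close>.\<close>
  have \<eta>': "\<eta> \<le> 1 / (4 * c)" "\<eta> * (2 * c * M) \<le> 1/2"
  proof -
    have "1 / (4 * c * M) \<le> 1 / (4 * c)" using c M by (intro divide_left_mono) (auto simp: mult_le_cancel_left1)
    then show "\<eta> \<le> 1 / (4 * c)" using \<eta> by simp
    show "\<eta> * (2 * c * M) \<le> 1/2" using \<eta> c M by (simp add: field_simps)
  qed
  have cb: "c * N0 b \<le> N0 a / 2"
  proof -
    have "c * N0 b \<le> c * (1 / (4 * c) * N0 a)"
      using b_le mult_right_mono[OF \<eta>'(1), of "N0 a"] pos c by (intro mult_left_mono) auto
    also have "\<dots> \<le> N0 a / 2" using c pos by simp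
    finally show ?thesis .
  qed
  have "N0 a \<le> c * (N0 b + N0 r)"
    using X0.triangle[of b r] br(1) r unfolding br(3)[symmetric] by blast
  then have low: "N0 a / 2 \<le> c * N0 r"
    using cb by (simp add: distrib_left)
  then have "r \<noteq> 0" using pos X0.zero by auto
  then have r_pos: "0 < N1 r" using X1.pos r by auto
  have "N0 r \<le> c * (N0 a + N0 b)"
    using X0.triangle[of a "- b"] br(1) a(1) X0.minus[of b] X0.neg_mem[of b] by (simp add: r_eq)
  also have "\<dots> \<le> c * N0 a + N0 a / 2" using cb by (simp add: distrib_left)
  also have "\<dots> \<le> 2 * c * N0 a" using c pos mult_right_mono[of 1 c "N0 a"] by simp
  finally have up: "N0 r \<le> 2 * c * N0 a" .
  have "N1 r * (2 * c * M) \<le> \<eta> * N1 a * (2 * c * M)"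
    using N1r c M by (intro mult_right_mono) auto
  also have "\<dots> \<le> N1 a / 2"
    using mult_right_mono[OF \<eta>'(2), of "N1 a"] pos by (simp add: algebra_simps)
  finally have N1r': "N1 r * (2 * c * M) \<le> N1 a / 2" .
  have "1 \<le> 2 * c * M" using c M mult_mono[of 1 c 1 M] by simp
  then have "N1 r \<le> N1 a / 2"
    using N1r' mult_left_mono[of 1 "2 * c * M" "N1 r"] r_pos by linarith
  moreover have "M * s \<le> N0 r / N1 r"
  proof -
    have "M * N0 a * N1 r \<le> M * (2 * c * N0 r) * N1 r"
      using low c M r_pos by (intro mult_right_mono mult_left_mono) auto
    also have "\<dots> = N0 r * (N1 r * (2 * c * M))" by simp
    also have "\<dots> \<le> N0 r * (N1 a / 2)"
      using N1r' X0.nonneg r by (intro mult_left_mono) auto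
    also have "\<dots> \<le> N0 r * N1 a" using X0.nonneg[of r] r pos by simp
    finally show ?thesis using pos r_pos by (simp add: s field_simps)
  qed
  moreover have "N0 (r - a) \<le> \<eta> * N0 a"
    using X0.minus[of b] br(1) b_le by (simp add: r_eq)
  ultimately show ?thesis
    using r \<open>r \<noteq> 0\<close> up by blast
qed

text \<open>If this failed, \<open>split_step\<close> could be iterated forever from an element of
  large ratio, and the limit of the remainders would contradict compatibility.\<close>

lemma ex_peaked_element:
  assumes \<gamma>: "0 < \<gamma>"
    and unbounded: "\<And>S. \<exists>a\<in>A0 \<inter> A1. a \<noteq> 0 \<and> S * N1 a \<le> N0 a"
  shows "\<exists>s\<ge>S. \<exists>a\<in>A0 \<inter> A1. N0 a = s \<and> N1 a = 1 \<and> s powr (1 - \<gamma>) \<le> K a s"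
proof (rule ccontr)
  assume contra: "\<not> ?thesis"
  have c: "1 \<le> c" by (rule X0.one_le)
  define ratio where "ratio a = N0 a / N1 a" for a
  \<comment> \<open>With \<open>4 * c^2 \<le> M powr \<gamma>\<close>, one factor \<open>2*c\<close>
    compensates the growth of \<open>N0\<close> along the iteration, the other supplies the
    geometric rate required for convergence. The bound on \<open>S'\<close> makes
    \<open>split_step\<close> applicable from the start.\<close>
  define M where "M = max c ((4 * c^2) powr (1/\<gamma>))"
  define S' where "S' = max S (max 1 ((4 * c * M) powr (1/\<gamma>)))"
  have M: "c \<le> M" "4 * c^2 \<le> M powr \<gamma>"
  proof -
    have "4 * c^2 = ((4 * c^2) powr (1/\<gamma>)) powr \<gamma>" using c \<gamma> by (simp add: powr_powr)
    also have "\<dots> \<le> M powr \<gamma>" using c \<gamma> by (intro powr_mono2) (auto simp: M_def)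
    finally show "4 * c^2 \<le> M powr \<gamma>" .
  qed (simp add: M_def)
  have S': "S \<le> S'" "1 \<le> S'" "4 * c * M \<le> S' powr \<gamma>"
  proof -
    have "4 * c * M = ((4 * c * M) powr (1/\<gamma>)) powr \<gamma>" using c M \<gamma> by (simp add: powr_powr)
    also have "\<dots> \<le> S' powr \<gamma>" using c \<gamma> by (intro powr_mono2) (auto simp: S'_def)
    finally show "4 * c * M \<le> S' powr \<gamma>" .
  qed (auto simp: S'_def)
  define G where "G = {a \<in> A0 \<inter> A1. a \<noteq> 0 \<and> S' \<le> ratio a}"
  \<comment> \<open>The negated claim concerns elements with \<open>N1 a = 1\<close>; homogeneity
    extends it to all of \<open>G\<close>.\<close>
  have K_small: "K a (ratio a) < ratio a powr (-\<gamma>) * N0 a" if "a \<in> G" for a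
  proof -
    have a: "a \<in> A0 \<inter> A1" "a \<noteq> 0" "S' \<le> ratio a" using that by (auto simp: G_def)
    have pos: "0 < N0 a" "0 < N1 a" using a X0.pos X1.pos by auto
    define a' where "a' = (1 / N1 a) *\<^sub>R a"
    have "a' \<in> A0 \<inter> A1" using a X0.scale_mem X1.scale_mem by (auto simp: a'_def)
    moreover have "N0 a' = ratio a" "N1 a' = 1"
      using a pos by (auto simp: a'_def X0.scale X1.scale ratio_def)
    ultimately have "K a' (ratio a) < ratio a powr (1 - \<gamma>)"
      using contra a(3) S'(1) by (meson leI order_trans)
    moreover have "(1 / N1 a) * K a (ratio a) \<le> K a' (ratio a)"
      unfolding a'_def using a pos A0_sum by (intro K_scale_ge) (auto simp: ratio_def)
    moreover have "K a (ratio a) = N1 a * ((1 / N1 a) * K a (ratio a))"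
      using pos by simp
    ultimately have "K a (ratio a) < N1 a * ratio a powr (1 - \<gamma>)"
      using pos by (metis le_less_trans mult_strict_left_mono)
    also have "\<dots> = ratio a powr (-\<gamma>) * N0 a"
      using a S' pos by (simp add: powr_diff powr_minus ratio_def field_simps)
    finally show ?thesis .
  qed
  have "\<exists>r\<in>G. N0 (r - a) \<le> ratio a powr (-\<gamma>) * N0 a \<and> N0 r \<le> 2 * c * N0 a \<and>
    M * ratio a \<le> ratio r \<and> N1 r \<le> N1 a / 2" if "a \<in> G" for a
  proof -
    have a: "a \<in> A0 \<inter> A1" "a \<noteq> 0" "S' \<le> ratio a" using that by (auto simp: G_def)
    have "4 * c * M \<le> ratio a powr \<gamma>"
      using S' a \<gamma> powr_mono2[of \<gamma> S' "ratio a"] by simp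
    then have "ratio a powr (-\<gamma>) \<le> 1 / (4 * c * M)"
      using c M by (simp add: powr_minus_divide frac_le)
    from split_step[OF a(1,2) refl _ this M(1)] K_small[OF that, unfolded ratio_def]
    obtain r where r: "r \<in> A0 \<inter> A1" "r \<noteq> 0" "N0 (r - a) \<le> ratio a powr (-\<gamma>) * N0 a"
      "N0 r \<le> 2 * c * N0 a" "M * ratio a \<le> ratio r" "N1 r \<le> N1 a / 2"
      unfolding ratio_def by blast
    \<comment> \<open>Since \<open>M \<ge> 1\<close>, the ratio stays above \<open>S'\<close> and
      the iteration never leaves \<open>G\<close>.\<close>
    have "1 * S' \<le> M * ratio a" using c M a S' by (intro mult_mono) auto
    then show ?thesis using r by (intro bexI[of _ r]) (auto simp: G_def)
  qed
  then obtain f where f: "\<And>a. a \<in> G \<Longrightarrow> f a \<in> G \<and> N0 (f a - a) \<le> ratio a powr (-\<gamma>) * N0 a \<and>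
    N0 (f a) \<le> 2 * c * N0 a \<and> M * ratio a \<le> ratio (f a) \<and> N1 (f a) \<le> N1 a / 2"
    by metis
  obtain a where a: "a \<in> A0 \<inter> A1" "a \<noteq> 0" "S' * N1 a \<le> N0 a" using unbounded by blast
  have pos: "0 < N0 a" "0 < N1 a" using a X0.pos X1.pos by auto
  have "a \<in> G" using a pos by (simp add: G_def ratio_def field_simps)
  define r where "r n = (f ^^ n) a" for n
  have r0: "r 0 = a" and rS: "r (Suc n) = f (r n)" for n by (simp_all add: r_def)
  have rG: "r n \<in> G" for n by (induction n) (auto simp: r0 rS \<open>a \<in> G\<close> f)
  have rA: "r n \<in> A0" "r n \<in> A1" for n using rG[of n] by (auto simp: G_def)
  have r_ratio: "M^n * S' \<le> ratio (r n)" for n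
  proof (induction n)
    case 0 then show ?case using rG[of 0] by (simp add: G_def)
  next
    case (Suc n)
    then have "M * (M^n * S') \<le> M * ratio (r n)" using c M by (intro mult_left_mono) auto
    then show ?case using f[OF rG[of n]] by (simp add: rS mult.assoc)
  qed
  have r_N0: "N0 (r n) \<le> (2*c)^n * N0 a" for n
  proof (induction n)
    case (Suc n)
    then have "2 * c * N0 (r n) \<le> 2 * c * ((2*c)^n * N0 a)" using c by (intro mult_left_mono) auto
    then show ?case using f[OF rG[of n]] by (simp add: rS mult.assoc)
  qed (simp add: r0)
  have r_N1: "N1 (r n) \<le> N1 a * (1/2)^n" for n
  proof (induction n)
    case (Suc n)
    then show ?case using f[OF rG[of n]] by (simp add: rS)
  qed (simp add: r0)
  \<comment> \<open>The factor \<open>M\<close> makes the final distance bound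
    \<open>c * (2 * c * D)\<close> at most \<open>N0 a / 2\<close>, because
    \<open>c \<le> M\<close>.\<close>
  define D where "D = N0 a / (4 * c * M)"
  have D: "0 \<le> D" using c M pos by (simp add: D_def)
  have incr: "N0 (r (Suc n) - r n) \<le> D / (2*c)^n" for n
  proof -
    have "(4*c^2)^n * (4 * c * M) \<le> (M powr \<gamma>)^n * S' powr \<gamma>"
      using c M S' by (intro mult_mono power_mono) auto
    also have "\<dots> = (M^n * S') powr \<gamma>"
    proof -
      have "(M^n) powr \<gamma> = (M powr \<gamma>)^n" using c M by (induction n) (auto simp: powr_mult)
      then show ?thesis using c M S' by (simp add: powr_mult)
    qed
    also have "\<dots> \<le> ratio (r n) powr \<gamma>"
      using c M S' \<gamma> r_ratio by (intro powr_mono2) auto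
    finally have "ratio (r n) powr (-\<gamma>) \<le> 1 / ((4*c^2)^n * (4 * c * M))"
      using c M by (simp add: powr_minus_divide frac_le)
    then have "ratio (r n) powr (-\<gamma>) * N0 (r n) \<le> 1 / ((4*c^2)^n * (4 * c * M)) * ((2*c)^n * N0 a)"
      using c M r_N0[of n] X0.nonneg[OF rA(1)[of n]]
      by (intro mult_mono) (simp_all del: power_mult_distrib)
    also have "\<dots> = D / (2*c)^n"
    proof -
      define X where "X = (2*c)^n"
      have "X > 0" using c by (simp add: X_def)
      have "4 * c^2 = (2*c) * (2*c)" by (simp add: power2_eq_square)
      then have XX: "(4*c^2)^n = X * X" unfolding X_def by (metis power_mult_distrib)
      show ?thesis
        unfolding D_def XX X_def[symmetric] using \<open>X > 0\<close> by simp
    qed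
    finally show ?thesis using f[OF rG[of n]] by (simp add: rS)
  qed
  obtain x where x: "x \<in> A0" "(\<lambda>n. N0 (r n - x)) \<longlonglongrightarrow> 0"
    using X0.geometric_increments_convergent[of r D] rA D incr by blast
  have "(\<lambda>n. N1 (r n - 0)) \<longlonglongrightarrow> 0"
  proof (rule tendsto_sandwich[where f = "\<lambda>_. 0" and h = "\<lambda>n. N1 a * (1/2)^n"])
    show "(\<lambda>n. N1 a * (1/2)^n) \<longlonglongrightarrow> 0"
      by (auto intro!: tendsto_eq_intros LIMSEQ_realpow_zero)
  qed (use rA X1.nonneg r_N1 in \<open>auto intro!: always_eventually\<close>)
  \<comment> \<open>The remainders converge to \<open>x\<close> in \<open>A0\<close> and to 0 in
    \<open>A1\<close>.\<close>
  then have "x = 0"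
    using compat[of r x 0] rA x X1.zero_mem by auto
  \<comment> \<open>The limit stays within \<open>N0 a / 2\<close> of the starting element, which is
    impossible for the limit 0.\<close>
  have "N0 (x - a) \<le> c * (2 * c * D)"
    using X0.limit_bound[of r x a "2 * c * D"] X0.chain_bound[of r D] rA x a D incr r0 by auto
  also have "\<dots> = (c / M) * (N0 a / 2)"
    using c by (simp add: D_def)
  also have "\<dots> \<le> N0 a / 2"
    using c M pos by (simp add: divide_le_eq)
  finally show False
    using pos X0.minus[of a] a \<open>x = 0\<close> by simp
qed

text \<open>Each hump \<open>v n\<close> satisfies the upper bound with the summable weight
  \<open>1 / (2*c)^n\<close>. At \<open>t = s n\<close> its own contribution exceeds
  \<open>n * s n powr \<theta>0\<close>, while all other humps together are of order at most
  \<open>s n powr \<theta>0\<close>.\<close>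

lemma ex_slow_decay:
  assumes \<theta>: "0 < \<theta>0" "\<theta>0 < \<theta>'" "\<theta>' < 1"
    and unbounded: "\<And>S. \<exists>a\<in>A0 \<inter> A1. a \<noteq> 0 \<and> S * N1 a \<le> N0 a"
  shows "\<exists>x\<in>A1. (\<exists>C. \<forall>t>0. K x t \<le> C * t powr \<theta>') \<and> \<not> (\<exists>C. \<forall>t>0. K x t \<le> C * t powr \<theta>0)"
proof -
  have c: "1 \<le> c" by (rule X0.one_le)
  \<comment> \<open>Half of the gap is lost to the peak estimate; the other half lets the humps beat
    exponent \<theta>0.\<close>
  define \<gamma> where "\<gamma> = (\<theta>' - \<theta>0) / 2"
  have \<gamma>: "0 < \<gamma>" "\<theta>' - \<gamma> = \<theta>0 + \<gamma>" using \<theta> by (auto simp: \<gamma>_def field_simps)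
  define good where "good s \<longleftrightarrow> (\<exists>a\<in>A0 \<inter> A1. N0 a = s \<and> N1 a = 1 \<and> s powr (1 - \<gamma>) \<le> K a s)" for s
  have ex_good: "\<exists>s. good s \<and> P s" if "eventually P at_top" for P
  proof -
    from that obtain S where "\<And>s. s \<ge> S \<Longrightarrow> P s" by (auto simp: eventually_at_top_linorder)
    then show ?thesis
      using ex_peaked_element[OF \<gamma>(1) unbounded, of S] unfolding good_def by blast
  qed
  have powr_large: "\<forall>\<^sub>F s in at_top. L \<le> s powr e" if "0 < e" for L e :: real
  proof (rule eventually_at_top_linorderI)
    fix s assume "max 1 L powr (1/e) \<le> s"
    then have "(max 1 L powr (1/e)) powr e \<le> s powr e" using that by (intro powr_mono2) auto
    then show "L \<le> s powr e" using that by (simp add: powr_powr)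
  qed
  have ex_next: "\<exists>s. good s \<and> 1 \<le> s \<and> L \<le> s powr \<gamma> \<and> r \<le> s \<and> r \<le> s powr \<theta>0 \<and> r \<le> s powr (1 - \<theta>')" for L r
    using \<gamma>(1) \<theta> by (intro ex_good eventually_conj eventually_ge_at_top powr_large) auto
  \<comment> \<open>The growth conditions have separate purposes: \<open>real n * (2*c)^n\<close>
    outweighs the geometric weight of hump \<open>n\<close>, the power \<theta>0 keeps earlier humps
    small, and the power \<open>1 - \<theta>'\<close> keeps later ones small.\<close>
  have "\<exists>s. \<forall>n. (good (s n) \<and> 1 \<le> s n \<and> real n * (2*c)^n \<le> s n powr \<gamma>) \<and>
     (s n \<le> s (Suc n) \<and> s n \<le> s (Suc n) powr \<theta>0 \<and> s n \<le> s (Suc n) powr (1 - \<theta>'))"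
    by (rule dependent_nat_choice) (meson ex_next)+
  then obtain s where s: "\<And>n. good (s n)" "\<And>n. 1 \<le> s n" "\<And>n. real n * (2*c)^n \<le> s n powr \<gamma>"
    "\<And>n. s n \<le> s (Suc n)" "\<And>n. s n \<le> s (Suc n) powr \<theta>0" "\<And>n. s n \<le> s (Suc n) powr (1 - \<theta>')"
    by blast
  have s_mono: "s m \<le> s n" if "m \<le> n" for m n
    using s(4) that by (rule lift_Suc_mono_le)
  have s_pos: "0 < s n" for n using s(2)[of n] by linarith
  obtain a where a: "\<And>n. a n \<in> A0 \<inter> A1" "\<And>n. N0 (a n) = s n" "\<And>n. N1 (a n) = 1"
    "\<And>n. s n powr (1 - \<gamma>) \<le> K (a n) (s n)"
    using s(1) unfolding good_def by metis
  \<comment> \<open>This scaling makes the bounds from \<open>N0\<close> and from \<open>N1\<close>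
    meet at \<open>t = s n\<close>, both with value
    \<open>s n powr \<theta>' / (2*c)^n\<close>.\<close>
  define d where "d n = s n powr (\<theta>' - 1) / (2*c)^n" for n
  have d: "0 < d n" for n using s_pos[of n] c by (simp add: d_def)
  define v where "v n = d n *\<^sub>R a n" for n
  have vA: "v n \<in> A0" "v n \<in> A1" for n using a(1)[of n] X0.scale_mem X1.scale_mem by (auto simp: v_def)
  have v0: "N0 (v n) = s n powr \<theta>' / (2*c)^n" for n
  proof -
    have "N0 (v n) = d n * s n"
      using a(1,2)[of n] d[of n] by (simp add: v_def X0.scale)
    also have "s n powr (\<theta>' - 1) * s n = s n powr \<theta>'"
      using s_pos[of n] by (simp add: powr_diff)
    then have "d n * s n = s n powr \<theta>' / (2*c)^n"
      by (simp add: d_def)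
    finally show ?thesis .
  qed
  have v1: "N1 (v n) = s n powr (\<theta>' - 1) / (2*c)^n" for n
    using a(1,3)[of n] d[of n] by (simp add: v_def X1.scale) (simp add: d_def)
  have vK: "s n powr (\<theta>' - \<gamma>) / (2*c)^n \<le> K (v n) (s n)" for n
  proof -
    have "s n powr (\<theta>' - \<gamma>) / (2*c)^n = d n * s n powr (1 - \<gamma>)"
      by (simp add: d_def powr_add[symmetric])
    also have "\<dots> \<le> d n * K (a n) (s n)" using a(4) d[of n] by simp
    also have "\<dots> \<le> K (v n) (s n)"
      unfolding v_def using a(1) A0_sum d[of n] s_pos[of n] by (intro K_scale_ge) auto
    finally show ?thesis .
  qed
  define u where "u n = (\<Sum>m<n. v m)" for n
  have u0: "u 0 = 0" and uS: "u (Suc n) - u n = v n" for n by (simp_all add: u_def)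
  have uA: "u n \<in> A0" "u n \<in> A1" for n
    using vA X0.subspace X1.subspace by (auto simp: u_def intro!: subspace_sum)
  have v1_le: "N1 (v n) \<le> 1 / (2*c)^n" for n
  proof -
    have "s n powr (\<theta>' - 1) \<le> s n powr 0" using s(2)[of n] \<theta> by (intro powr_mono) auto
    then show ?thesis using c s_pos[of n] unfolding v1 by (intro divide_right_mono) auto
  qed
  obtain x where x: "x \<in> A1" "(\<lambda>n. N1 (u n - x)) \<longlonglongrightarrow> 0"
    using X1.geometric_increments_convergent[of u 1] uA v1_le by (auto simp: uS)
  have bound: "K x t \<le> 2 * c^2 * t powr \<theta>'" if t: "t > 0" for t
  proof -
    interpret Kt: quasi_seminorm "A0 + A1" "\<lambda>x. K x t" c
      using t by (intro K_seminorm) simp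
    \<comment> \<open>Beyond \<open>s m\<close> the hump is placed entirely in \<open>A0\<close>,
      before it entirely in \<open>A1\<close>.\<close>
    have "K (v m) t \<le> t powr \<theta>' / (2*c)^m" for m
    proof (cases "s m \<le> t")
      case True
      have "K (v m) t \<le> N0 (v m)" using vA t by (intro K_le_N0) auto
      also have "\<dots> \<le> t powr \<theta>' / (2*c)^m"
        unfolding v0 using True s_pos[of m] \<theta> c by (intro divide_right_mono powr_mono2) auto
      finally show ?thesis .
    next
      case False
      have "K (v m) t \<le> t * N1 (v m)" using vA t by (intro K_le_N1) auto
      also have "\<dots> \<le> t * (t powr (\<theta>' - 1) / (2*c)^m)"
        unfolding v1 using False t \<theta> c by (intro mult_left_mono divide_right_mono powr_mono2') auto
      also have "\<dots> = t powr \<theta>' / (2*c)^m" using t by (simp add: powr_diff)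
      finally show ?thesis .
    qed
    then have Ku: "K (u n) t \<le> 2 * c * t powr \<theta>'" for n
      using Kt.chain_bound[of u "t powr \<theta>'" n] uA A0_sum by (simp add: uS u0)
    show ?thesis
    proof (rule LIMSEQ_le_const)
      \<comment> \<open>The partial sums are bounded uniformly in \<open>n\<close>, and the
        remaining part of \<open>x\<close> costs at most \<open>t\<close> times its
        \<open>N1\<close>, which tends to 0.\<close>
      have "(\<lambda>n. c * (2 * c * t powr \<theta>' + t * N1 (u n - x))) \<longlonglongrightarrow> c * (2 * c * t powr \<theta>' + t * 0)"
        by (intro tendsto_intros x(2))
      then show "(\<lambda>n. c * (2 * c * t powr \<theta>' + t * N1 (u n - x))) \<longlonglongrightarrow> 2 * c^2 * t powr \<theta>'"
        by (simp add: power2_eq_square mult_ac)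
      have "K x t \<le> c * (2 * c * t powr \<theta>' + t * N1 (u n - x))" for n
      proof -
        have "K x t \<le> c * (K (u n) t + K (x - u n) t)"
          using Kt.triangle[of "u n" "x - u n"] uA x A1_sum X1.diff_mem by simp
        also have "\<dots> \<le> c * (2 * c * t powr \<theta>' + t * N1 (u n - x))"
          using K_le_N1[of "x - u n" t] X1.commute[of x "u n"] uA x t X1.diff_mem c Ku[of n]
          by (intro mult_left_mono add_mono) auto
        finally show ?thesis .
      qed
      then show "\<exists>n0. \<forall>n\<ge>n0. K x t \<le> c * (2 * c * t powr \<theta>' + t * N1 (u n - x))" by blast
    qed
  qed
  have "\<not> (\<exists>C. \<forall>t>0. K x t \<le> C * t powr \<theta>0)"
  proof
    assume "\<exists>C. \<forall>t>0. K x t \<le> C * t powr \<theta>0"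
    then obtain C where C: "\<And>t. t > 0 \<Longrightarrow> K x t \<le> C * t powr \<theta>0" by blast
    have "real (Suc k) \<le> c * (C + (2 * c + 2 * c^2))" for k
    proof -
      \<comment> \<open>The tested hump has a predecessor \<open>k\<close>, whose size
        \<open>s k \<le> s n powr \<theta>0\<close> dominates all earlier humps.\<close>
      define n where "n = Suc k"
      define T where "T = s n powr \<theta>0"
      have T: "1 \<le> T" using s(2)[of n] \<theta> by (simp add: T_def ge_one_powr_ge_zero)
      have "N0 (v m) \<le> s k / (2*c)^m" if "m < n" for m
      proof -
        have "s m powr \<theta>' \<le> s m powr 1" using s(2)[of m] \<theta> by (intro powr_mono) auto
        also have "\<dots> \<le> s k" using s_pos[of m] s_mono[of m k] that by (simp add: n_def)
        finally show ?thesis using c by (simp add: v0 divide_right_mono)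
      qed
      then have "N0 (u n) \<le> 2 * c * s k"
        using X0.chain_bound[of u "s k" n] uA s_pos[of k] by (simp add: uS u0)
      also have "\<dots> \<le> 2 * c * T" using s(5)[of k] c by (simp add: T_def n_def)
      finally have head: "N0 (- u n) \<le> 2 * c * T" using X0.minus uA by simp
      \<comment> \<open>Later humps are measured in \<open>A1\<close>: a total of order
        \<open>1 / s n\<close> there costs only a constant at \<open>t = s n\<close>.\<close>
      have "N1 (v (Suc n + m)) \<le> (1 / s n) / (2*c)^m" for m
      proof -
        have "s n \<le> s (Suc n + m) powr (1 - \<theta>')"
          using s(6)[of "n + m"] s_mono[of n "n + m"] by simp
        then have "s (Suc n + m) powr (\<theta>' - 1) \<le> 1 / s n"
          using s_pos[of n] powr_minus_divide[of "s (Suc n + m)" "1 - \<theta>'"] by (simp add: frac_le)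
        moreover have "(2*c)^m \<le> (2*c)^(Suc n + m)" using c by (intro power_increasing) auto
        ultimately show ?thesis
          unfolding v1 using c s_pos[of n] by (intro frac_le) auto
      qed
      then have "N1 (u (Suc n + m) - u (Suc n)) \<le> 2 * c * (1 / s n)" for m
        using X1.chain_bound[of "\<lambda>k. u (Suc n + k)" "1 / s n" m] uA s_pos[of n] uS[of "Suc n + _"]
        by simp
      moreover have "(\<lambda>m. N1 (u (Suc n + m) - x)) \<longlonglongrightarrow> 0"
        using LIMSEQ_ignore_initial_segment[OF x(2), of "Suc n"] by (simp add: add.commute)
      ultimately have "N1 (x - u (Suc n)) \<le> c * (2 * c * (1 / s n))"
        using X1.limit_bound[of "\<lambda>m. u (Suc n + m)" x "u (Suc n)"] uA x by blast
      then have tail: "s n * N1 (u (Suc n) - x) \<le> 2 * c^2"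
        using s_pos[of n] X1.commute[of x "u (Suc n)"] uA x by (simp add: field_simps power2_eq_square)
      have "real n * T \<le> s n powr \<gamma> / (2*c)^n * T"
        using s(3)[of n] T c by (intro mult_right_mono) (auto simp: pos_le_divide_eq)
      also have "\<dots> = s n powr (\<theta>' - \<gamma>) / (2*c)^n"
        by (simp add: \<gamma>(2) powr_add T_def)
      also have "\<dots> \<le> K (v n) (s n)" by (rule vK)
      \<comment> \<open>Hump \<open>n\<close> is \<open>x\<close> with the earlier humps removed in
        \<open>A0\<close> and the later ones removed in \<open>A1\<close>.\<close>
      also have "\<dots> = K (x + (- u n + (u (Suc n) - x))) (s n)" by (simp flip: uS)
      also have "\<dots> \<le> c * (K x (s n) + K (- u n + (u (Suc n) - x)) (s n))"
        using s_pos[of n] x(1) uA X0.neg_mem X1.diff_mem A1_sum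
        by (intro K_triangle set_plus_intro) (auto simp: less_imp_le)
      also have "\<dots> \<le> c * (C * T + (2 * c + 2 * c^2) * T)"
      proof (intro mult_left_mono add_mono)
        show "K x (s n) \<le> C * T" unfolding T_def by (rule C[OF s_pos])
        have "K (- u n + (u (Suc n) - x)) (s n) \<le> N0 (- u n) + s n * N1 (u (Suc n) - x)"
          using s_pos[of n] x(1) uA X0.neg_mem X1.diff_mem by (intro K_le) (auto simp: less_imp_le)
        also have "\<dots> \<le> 2 * c * T + 2 * c^2 * T"
          using head tail mult_left_mono[OF T, of "2 * c^2"] by simp
        finally show "K (- u n + (u (Suc n) - x)) (s n) \<le> (2 * c + 2 * c^2) * T"
          by (simp add: distrib_right)
      qed (use c in simp)
      also have "\<dots> = c * (C + (2 * c + 2 * c^2)) * T" by (simp add: algebra_simps)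
      finally show ?thesis using T by (simp add: n_def)
    qed
    then show False
      using reals_Archimedean2[of "c * (C + (2 * c + 2 * c^2))"] by (smt (verit) of_nat_Suc)
  qed
  with bound x show ?thesis by blast
qed

section \<open>Comparison of interpolation spaces\<close>

text \<open>Combines \<open>K_swap\<close> with the invariance of \<open>dt/t\<close> under
  inversion.\<close>

lemma interpolation_space_swap:
  "interpolation_space A1 N1 A0 N0 \<theta> p = interpolation_space A0 N0 A1 N1 (1 - \<theta>) p"
proof (intro set_eqI)
  fix x
  show "x \<in> interpolation_space A1 N1 A0 N0 \<theta> p \<longleftrightarrow> x \<in> interpolation_space A0 N0 A1 N1 (1 - \<theta>) p"
  proof (cases "x \<in> A0 + A1")
    case True
    define h where "h t = (t powr (-(1 - \<theta>)) * K x t) powr p" for t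
    \<comment> \<open>Monotonicity in \<open>t\<close> supplies the measurability needed for the
      change of variables.\<close>
    have "mono_on {0<..} (K x)"
      using True K_mono by (auto intro!: mono_onI)
    then have "K x \<in> borel_measurable (restrict_space borel {0<..})"
      by (rule borel_measurable_mono_on_fnc)
    moreover have "(\<lambda>t. t powr (-(1 - \<theta>))) \<in> borel_measurable (restrict_space borel {0<..})"
      by (intro measurable_restrict_space1) simp
    ultimately have h_meas: "h \<in> borel_measurable (restrict_space borel {0<..})"
      unfolding h_def by measurable
    have "h (1/t) = (t powr (-\<theta>) * K_functional A1 N1 A0 N0 x t) powr p" if "t > 0" for t
    proof -
      have "(1/t) powr (-(1 - \<theta>)) * K x (1/t) = t powr (-\<theta>) * (t * K x (1/t))"
        using that by (simp add: powr_divide powr_diff powr_minus field_simps)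
      then show ?thesis by (simp only: h_def K_swap[OF True that])
    qed
    then have "(\<integral>\<^sup>+t\<in>{0<..}. ennreal ((t powr (-\<theta>) * K_functional A1 N1 A0 N0 x t) powr p / t) \<partial>lborel) =
      (\<integral>\<^sup>+t\<in>{0<..}. ennreal (h (1/t) / t) \<partial>lborel)"
      by (intro nn_integral_cong) (auto simp: indicator_def)
    then show ?thesis
      using nn_integral_finite_inversion[OF h_meas] True
      by (simp add: interpolation_space_iff h_def add.commute[of A1 A0])
  qed (simp add: interpolation_space_iff add.commute[of A1 A0])
qed

text \<open>Otherwise \<open>ex_slow_decay\<close> at an intermediate exponent gives an element of
  the first space outside the second. Pure power bounds decide both memberships, so \<open>p\<close>
  and \<open>q\<close> need not be related.\<close>

lemma interpolation_space_subset_imp_dominated: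
  assumes "0 < \<theta>0" "\<theta>0 < \<theta>1" "\<theta>1 < 1" "0 < p" "0 < q"
    and subset: "interpolation_space A0 N0 A1 N1 \<theta>1 q \<subseteq> interpolation_space A0 N0 A1 N1 \<theta>0 p"
  shows "\<exists>S. \<forall>a\<in>A0 \<inter> A1. N0 a \<le> S * N1 a"
proof (rule ccontr)
  assume not_dominated: "\<not> ?thesis"
  have unbounded: "\<exists>a\<in>A0 \<inter> A1. a \<noteq> 0 \<and> S * N1 a \<le> N0 a" for S
  proof -
    obtain a where a: "a \<in> A0 \<inter> A1" "S * N1 a < N0 a"
      using not_dominated by (auto simp: not_le)
    then have "a \<noteq> 0" using X0.zero X1.zero by auto
    with a show ?thesis by (intro bexI[of _ a]) auto
  qed
  define \<theta>' where "\<theta>' = (\<theta>0 + \<theta>1) / 2"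
  have \<theta>': "\<theta>0 < \<theta>'" "\<theta>' < \<theta>1" "\<theta>' < 1" using assms by (auto simp: \<theta>'_def)
  obtain x C where x: "x \<in> A1" and C: "\<And>t. t > 0 \<Longrightarrow> K x t \<le> C * t powr \<theta>'"
    and not: "\<not> (\<exists>C. \<forall>t>0. K x t \<le> C * t powr \<theta>0)"
    using ex_slow_decay[OF assms(1) \<theta>'(1,3) unbounded] by blast
  have x_sum: "x \<in> A0 + A1" by (rule A1_sum[OF x])
  have "x \<in> interpolation_space A0 N0 A1 N1 \<theta>1 q"
    unfolding interpolation_space_iff
  proof (intro conjI nn_integral_powr_finite)
    show "K x t \<le> N1 x * t" if "t > 0" for t
      using K_le_N1[OF x, of t] that by (simp add: mult.commute)
  qed (use x_sum C K_nonneg[OF x_sum] \<theta>' assms in auto)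
  moreover have "x \<notin> interpolation_space A0 N0 A1 N1 \<theta>0 p"
    unfolding interpolation_space_iff
    using nn_integral_powr_finite_imp_bound[of \<theta>0 p "K x"] not K_nonneg[OF x_sum] K_mono[OF x_sum] assms
    by auto
  ultimately show False using subset by blast
qed

text \<open>If the two quasi-norms are equivalent on the intersection, a sequence in it that
  converges in the sum is Cauchy in both spaces, and compatibility identifies the limits.\<close>

lemma closedin_intersection:
  assumes S: "\<And>a. a \<in> A0 \<inter> A1 \<Longrightarrow> N0 a \<le> S * N1 a" "\<And>a. a \<in> A0 \<inter> A1 \<Longrightarrow> N1 a \<le> S * N0 a"
  shows "closedin (quasi_norm_topology (A0 + A1) (sum_quasi_norm A0 N0 A1 N1)) (A0 \<inter> A1)"
  unfolding closedin_def openin_quasi_norm_topology topspace_quasi_norm_topology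
proof (intro conjI ballI)
  have c: "1 \<le> c" by (rule X0.one_le)
  show "A0 \<inter> A1 \<subseteq> A0 + A1" using A0_sum by blast
  fix x assume x: "x \<in> A0 + A1 - A0 \<inter> A1"
  show "\<exists>r>0. \<forall>y\<in>A0 + A1. sum_quasi_norm A0 N0 A1 N1 (y - x) < r \<longrightarrow> y \<in> A0 + A1 - A0 \<inter> A1"
  proof (rule ccontr)
    assume "\<not> ?thesis"
    then have "\<exists>y. y \<in> A0 \<inter> A1 \<and> K (y - x) 1 < 1 / real (Suc n)" for n
      unfolding sum_quasi_norm_def by (metis DiffI of_nat_0_less_iff zero_less_Suc zero_less_divide_1_iff)
    then obtain y where y: "\<And>n. y n \<in> A0 \<inter> A1" "\<And>n. K (y n - x) 1 < 1 / real (Suc n)"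
      by metis
    have "\<exists>a b. a \<in> A0 \<and> b \<in> A1 \<and> y n - x = a + b \<and> N0 a + N1 b < 1 / real (Suc n)" for n
    proof (rule K_lessE[OF _ y(2)])
      show "y n - x \<in> A0 + A1"
        using subspace_diff[OF subspace_add_spaces] y(1)[of n] x A0_sum by blast
    qed auto
    then obtain a b where ab: "\<And>n. a n \<in> A0" "\<And>n. b n \<in> A1" "\<And>n. y n - x = a n + b n"
      "\<And>n. N0 (a n) + N1 (b n) < 1 / real (Suc n)" by metis
    have a_le: "N0 (a n) \<le> 1 / real (Suc n)" and b_le: "N1 (b n) \<le> 1 / real (Suc n)" for n
      using ab(4)[of n] X0.nonneg[OF ab(1)[of n]] X1.nonneg[OF ab(2)[of n]] by linarith+
    have lim_a: "(\<lambda>n. N0 (a n)) \<longlonglongrightarrow> 0" and lim_b: "(\<lambda>n. N1 (b n)) \<longlonglongrightarrow> 0"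
      by (rule tendsto_sandwich[OF _ _ tendsto_const LIMSEQ_inverse_real_of_nat];
          use a_le b_le X0.nonneg[OF ab(1)] X1.nonneg[OF ab(2)] in \<open>simp add: inverse_eq_divide\<close>)+
    have cauchy: "\<exists>M. \<forall>m\<ge>M. \<forall>n\<ge>M. N0 (y m - y n) < e \<and> N1 (y m - y n) < e" if "e > 0" for e
    proof -
      \<comment> \<open>In either quasi-norm one of the two parts of \<open>y m - y n\<close> is
        bounded by \<kappa> directly and the other, through \<open>S\<close>, by
        \<open>(R - 1) * \<kappa>\<close>.\<close>
      define R where "R = 1 + \<bar>S\<bar>"
      have R: "0 < R" "S \<le> R - 1" by (auto simp: R_def)
      obtain M where M: "inverse (real (Suc M)) < e / (2 * c^2 * R)"
        using reals_Archimedean[of "e / (2 * c^2 * R)"] \<open>e > 0\<close> c R by auto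
      define \<kappa> where "\<kappa> = c * (2 / real (Suc M))"
      have "c * R * \<kappa> = 2 * c^2 * R * inverse (real (Suc M))"
        by (simp add: \<kappa>_def power2_eq_square divide_inverse)
      also have "\<dots> < e" using M c R by (simp add: pos_less_divide_eq mult.commute)
      finally have \<kappa>: "c * R * \<kappa> < e" .
      have "N0 (y m - y n) < e \<and> N1 (y m - y n) < e" if mn: "m \<ge> M" "n \<ge> M" for m n
      proof -
        define v w where "v = a m - a n" and "w = b m - b n"
        have vw: "y m - y n = v + w"
          using ab(3)[of m] ab(3)[of n] by (simp add: v_def w_def algebra_simps)
        have vA: "v \<in> A0" and wA: "w \<in> A1"
          using ab(1,2) X0.diff_mem X1.diff_mem by (auto simp: v_def w_def)
        have "v + w \<in> A0 \<inter> A1"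
          unfolding vw[symmetric] using y(1) X0.diff_mem X1.diff_mem by blast
        \<comment> \<open>Since the sum lies in both spaces, so does each part, and the equivalence
          of the quasi-norms applies to it.\<close>
        then have v: "v \<in> A0 \<inter> A1" and w: "w \<in> A0 \<inter> A1"
          using vA wA X0.diff_mem[of "v + w" v] X1.diff_mem[of "v + w" w] by auto
        have small: "1 / real (Suc k) \<le> 1 / real (Suc M)" if "M \<le> k" for k
          using that by (intro divide_left_mono) auto
        have "N0 v \<le> c * (N0 (a m) + N0 (a n))"
          using X0.triangle[of "a m" "- a n"] ab(1) X0.neg_mem X0.minus by (simp add: v_def)
        also have "\<dots> \<le> \<kappa>"
          unfolding \<kappa>_def using a_le[of m] a_le[of n] small[OF mn(1)] small[OF mn(2)] c
          by (intro mult_left_mono) linarith+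
        finally have v0: "N0 v \<le> \<kappa>" .
        have "N1 w \<le> c * (N1 (b m) + N1 (b n))"
          using X1.triangle[of "b m" "- b n"] ab(2) X1.neg_mem X1.minus by (simp add: w_def)
        also have "\<dots> \<le> \<kappa>"
          unfolding \<kappa>_def using b_le[of m] b_le[of n] small[OF mn(1)] small[OF mn(2)] c
          by (intro mult_left_mono) linarith+
        finally have w1: "N1 w \<le> \<kappa>" .
        have S_le: "S * r \<le> (R - 1) * \<kappa>" if "0 \<le> r" "r \<le> \<kappa>" for r
          using that R by (intro mult_mono) (auto simp: R_def)
        have v1: "N1 v \<le> (R - 1) * \<kappa>"
          using S(2)[OF v] S_le[OF X0.nonneg[OF vA] v0] by linarith
        have w0: "N0 w \<le> (R - 1) * \<kappa>"
          using S(1)[OF w] S_le[OF X1.nonneg[OF wA] w1] by linarith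
        have "N0 (v + w) \<le> c * (\<kappa> + (R - 1) * \<kappa>)"
          using v w c by (intro order_trans[OF X0.triangle] mult_left_mono add_mono v0 w0) auto
        moreover have "N1 (v + w) \<le> c * (\<kappa> + (R - 1) * \<kappa>)"
          unfolding add.commute[of v w]
          using v w c by (intro order_trans[OF X1.triangle] mult_left_mono add_mono v1 w1) auto
        moreover have "c * (\<kappa> + (R - 1) * \<kappa>) = c * R * \<kappa>" by (simp add: algebra_simps)
        ultimately show ?thesis using \<kappa> by (simp add: vw)
      qed
      then show ?thesis by blast
    qed
    obtain z where z: "z \<in> A0" "(\<lambda>n. N0 (y n - z)) \<longlonglongrightarrow> 0"
      using X0.complete[of y] y(1) cauchy by (metis IntD1)
    obtain z' where z': "z' \<in> A1" "(\<lambda>n. N1 (y n - z')) \<longlonglongrightarrow> 0"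
      using X1.complete[of y] y(1) cauchy by (metis IntD2)
    have "z' = z" using compat[of y z z'] y(1) z z' by blast
    obtain a' b' where x_eq: "a' \<in> A0" "b' \<in> A1" "x = a' + b'"
      using x by (blast elim: set_plus_elim)
    \<comment> \<open>Rewriting \<open>y n - a n\<close> as \<open>x + b n\<close> shows that
      \<open>f n\<close> equals \<open>b n + b'\<close>. So it lies in both spaces and tends to
      \<open>z - a'\<close> in \<open>A0\<close> and to \<open>b'\<close> in
      \<open>A1\<close>.\<close>
    define f where "f n = y n - a n - a'" for n
    have f_alt: "f n = b n + b'" for n
      using ab(3)[of n] by (simp add: f_def x_eq(3) algebra_simps)
    have "f n \<in> A0 \<inter> A1" for n
    proof
      show "f n \<in> A0" unfolding f_def using y(1) ab(1) x_eq(1) by (intro X0.diff_mem) auto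
      show "f n \<in> A1" unfolding f_alt using ab(2) x_eq(2) by (intro X1.add_mem)
    qed
    moreover have "(\<lambda>n. N0 (f n - (z - a'))) \<longlonglongrightarrow> 0"
    proof (rule tendsto_sandwich[OF _ _ tendsto_const])
      have "N0 (f n - (z - a')) \<le> c * (N0 (y n - z) + N0 (a n))" for n
        using X0.triangle[of "y n - z" "- a n"] X0.minus ab(1) y(1) z(1) X0.diff_mem X0.neg_mem
        by (simp add: f_def algebra_simps)
      then show "\<forall>\<^sub>F n in sequentially. N0 (f n - (z - a')) \<le> c * (N0 (y n - z) + N0 (a n))" by simp
      show "(\<lambda>n. c * (N0 (y n - z) + N0 (a n))) \<longlonglongrightarrow> 0"
        using lim_a z(2) by (auto intro!: tendsto_eq_intros)
    qed (use X0.nonneg X0.diff_mem y(1) ab(1) x_eq(1) z(1) in \<open>simp add: f_def\<close>)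
    moreover have "(\<lambda>n. N1 (f n - b')) \<longlonglongrightarrow> 0"
      using lim_b by (simp add: f_alt)
    ultimately have "z - a' = b'"
      using compat[of f "z - a'" b'] X0.diff_mem z(1) x_eq(1,2) by blast
    then have "x = z" by (simp add: x_eq(3) algebra_simps)
    then show False using x z(1) z'(1) \<open>z' = z\<close> by blast
  qed
qed (rule Diff_subset)

text \<open>Equality gives two inclusions, and each makes one quasi-norm dominate the other on the
  intersection, which would then be closed.\<close>

lemma interpolation_spaces_differ:
  assumes not_closed: "\<not> closedin (quasi_norm_topology (A0 + A1) (sum_quasi_norm A0 N0 A1 N1)) (A0 \<inter> A1)"
    and \<theta>: "0 < \<theta>0" "\<theta>0 < \<theta>1" "\<theta>1 < 1" and pq: "0 < p" "0 < q"
  shows "interpolation_space A0 N0 A1 N1 \<theta>0 p \<noteq> interpolation_space A0 N0 A1 N1 \<theta>1 q"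
proof
  interpret S: quasi_couple A1 A0 N1 N0 c by (rule swap)
  assume eq: "interpolation_space A0 N0 A1 N1 \<theta>0 p = interpolation_space A0 N0 A1 N1 \<theta>1 q"
  have "\<exists>S. \<forall>a\<in>A0 \<inter> A1. N0 a \<le> S * N1 a"
    by (rule interpolation_space_subset_imp_dominated[OF \<theta> pq]) (simp add: eq)
  then obtain S0 where S0: "\<And>a. a \<in> A0 \<inter> A1 \<Longrightarrow> N0 a \<le> S0 * N1 a" by blast
  \<comment> \<open>Exchanging the spaces replaces \<theta> by \<open>1 - \<theta>\<close> and so
    reverses the order of the parameters, which makes the other inclusion usable.\<close>
  have "\<exists>S. \<forall>a\<in>A1 \<inter> A0. N1 a \<le> S * N0 a"
    by (rule S.interpolation_space_subset_imp_dominated[of "1 - \<theta>1" "1 - \<theta>0" q p])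
      (use \<theta> pq in \<open>simp_all add: interpolation_space_swap eq\<close>)
  then obtain S1 where S1: "\<And>a. a \<in> A0 \<inter> A1 \<Longrightarrow> N1 a \<le> S1 * N0 a" by blast
  have "closedin (quasi_norm_topology (A0 + A1) (sum_quasi_norm A0 N0 A1 N1)) (A0 \<inter> A1)"
  proof (rule closedin_intersection)
    fix a assume a: "a \<in> A0 \<inter> A1"
    then have "0 \<le> N0 a" "0 \<le> N1 a" using X0.nonneg X1.nonneg by auto
    then show "N0 a \<le> max S0 S1 * N1 a" "N1 a \<le> max S0 S1 * N0 a"
      using S0[OF a] S1[OF a] mult_right_mono[of S0 "max S0 S1" "N1 a"] mult_right_mono[of S1 "max S0 S1" "N0 a"]
      by auto
  qed
  with not_closed show False by blast
qed

end

section \<open>From the topological definitions to the working locales\<close>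

lemma limitin_quasi_norm_topology:
  assumes "\<And>n. f n \<in> A" "x \<in> A" "(\<lambda>n. N (f n - x)) \<longlonglongrightarrow> 0"
  shows "limitin (quasi_norm_topology A N) f x sequentially"
  unfolding limitin_def
proof (intro conjI allI impI)
  fix U assume "openin (quasi_norm_topology A N) U \<and> x \<in> U"
  then obtain r where r: "r > 0" "\<And>y. y \<in> A \<Longrightarrow> N (y - x) < r \<Longrightarrow> y \<in> U"
    unfolding openin_quasi_norm_topology by blast
  have "\<forall>\<^sub>F n in sequentially. N (f n - x) < r"
    using assms(3) r(1) by (rule order_tendstoD)
  then show "\<forall>\<^sub>F n in sequentially. f n \<in> U"
    by eventually_elim (use assms(1) r(2) in blast)
qed (simp add: topspace_quasi_norm_topology assms(2))

text \<open>A quasi-triangle constant may be enlarged; having all large constants available lets the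
  two spaces of a couple share one.\<close>

lemma quasi_banach_of_quasi_Banach_space:
  assumes "quasi_Banach_space A N"
  shows "\<exists>c0. \<forall>c\<ge>c0. quasi_banach A N c"
proof -
  from assms have Q: "quasi_normed_space A N" by (simp add: quasi_Banach_space_def)
  have A: "subspace A" "\<And>x. x \<in> A \<Longrightarrow> 0 \<le> N x" "\<And>x. x \<in> A \<Longrightarrow> N x = 0 \<longleftrightarrow> x = 0"
    "\<And>r x. x \<in> A \<Longrightarrow> N (r *\<^sub>R x) = \<bar>r\<bar> * N x"
    using Q by (simp_all add: quasi_normed_space_def)
  obtain c0 where c0: "1 \<le> c0" "\<And>x y. x \<in> A \<Longrightarrow> y \<in> A \<Longrightarrow> N (x + y) \<le> c0 * (N x + N y)"
    using Q unfolding quasi_normed_space_def by meson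
  have "quasi_banach A N c" if "c \<ge> c0" for c
  proof
    fix x y assume "x \<in> A" "y \<in> A"
    then show "N (x + y) \<le> c * (N x + N y)"
      using c0(2) A(2) that by (meson add_nonneg_nonneg mult_right_mono order_trans)
  next
    fix f :: "nat \<Rightarrow> 'a"
    assume "\<And>n. f n \<in> A" "\<And>e. e > 0 \<Longrightarrow> \<exists>M. \<forall>m\<ge>M. \<forall>n\<ge>M. N (f m - f n) < e"
    then show "\<exists>x\<in>A. (\<lambda>n. N (f n - x)) \<longlonglongrightarrow> 0"
      using assms unfolding quasi_Banach_space_def by blast
  qed (use A subspace_0[OF A(1)] c0(1) that in auto)
  then show ?thesis by blast
qed

lemma quasi_couple_of_quasi_Banach_couple:
  assumes "quasi_Banach_couple A0 N0 A1 N1"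
  shows "\<exists>c. quasi_couple A0 A1 N0 N1 c"
proof -
  from assms obtain T where T: "Hausdorff_space T"
    "continuous_map (quasi_norm_topology A0 N0) T (\<lambda>x. x)"
    "continuous_map (quasi_norm_topology A1 N1) T (\<lambda>x. x)"
    and ban: "quasi_Banach_space A0 N0" "quasi_Banach_space A1 N1"
    unfolding quasi_Banach_couple_def Hausdorff_topological_vector_space_def by blast
  obtain c0 c1 where c: "\<And>c. c \<ge> c0 \<Longrightarrow> quasi_banach A0 N0 c" "\<And>c. c \<ge> c1 \<Longrightarrow> quasi_banach A1 N1 c"
    using ban[THEN quasi_banach_of_quasi_Banach_space] by blast
  \<comment> \<open>Both embeddings are continuous, so the sequence tends to \<open>x\<close> and to
    \<open>y\<close> in the Hausdorff space \<open>T\<close>.\<close>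
  have compat: "x = y" if f: "\<And>n. f n \<in> A0 \<inter> A1" and "x \<in> A0" "y \<in> A1"
    "(\<lambda>n. N0 (f n - x)) \<longlonglongrightarrow> 0" "(\<lambda>n. N1 (f n - y)) \<longlonglongrightarrow> 0" for f x y
  proof (rule limitin_Hausdorff_unique)
    show "limitin T f x sequentially"
      using continuous_map_limit[OF T(2) limitin_quasi_norm_topology[of f A0 x N0]] that by (simp add: o_def)
    show "limitin T f y sequentially"
      using continuous_map_limit[OF T(3) limitin_quasi_norm_topology[of f A1 y N1]] that by (simp add: o_def)
  qed (simp_all add: T)
  have "quasi_couple A0 A1 N0 N1 (max c0 c1)"
    unfolding quasi_couple_def quasi_couple_axioms_def
    using c compat by (smt (verit))
  then show ?thesis by blast
qed

theorem theorem2p8: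
  fixes A0 A1 :: "'v::real_vector set" and N0 N1 :: "'v \<Rightarrow> real"
  assumes "quasi_Banach_couple A0 N0 A1 N1"
    and "\<not> closedin (quasi_norm_topology (A0 + A1) (sum_quasi_norm A0 N0 A1 N1)) (A0 \<inter> A1)"
  shows "(\<forall>\<theta> p :: real. 0 < \<theta> \<and> \<theta> < 1 \<and> \<theta> \<noteq> 1/2 \<and> 0 < p \<longrightarrow>
            interpolation_space A0 N0 A1 N1 \<theta> p \<noteq> interpolation_space A0 N0 A1 N1 (1 - \<theta>) p \<and>
            interpolation_space A0 N0 A1 N1 (1 - \<theta>) p = interpolation_space A1 N1 A0 N0 \<theta> p) \<and>
         (\<forall>\<theta>0 \<theta>1 p q :: real. 0 < \<theta>0 \<and> \<theta>0 < 1 \<and> 0 < \<theta>1 \<and> \<theta>1 < 1 \<and> \<theta>0 \<noteq> \<theta>1 \<and> 0 < p \<and> 0 < q \<longrightarrow>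
            interpolation_space A0 N0 A1 N1 \<theta>0 p \<noteq> interpolation_space A0 N0 A1 N1 \<theta>1 q \<or>
            interpolation_space A1 N1 A0 N0 \<theta>0 p \<noteq> interpolation_space A1 N1 A0 N0 \<theta>1 q)"
proof -
  obtain c where "quasi_couple A0 A1 N0 N1 c"
    using quasi_couple_of_quasi_Banach_couple[OF assms(1)] by blast
  then interpret quasi_couple A0 A1 N0 N1 c .
  have differ: "interpolation_space A0 N0 A1 N1 \<theta>0 p \<noteq> interpolation_space A0 N0 A1 N1 \<theta>1 q"
    if "0 < \<theta>0" "\<theta>0 < 1" "0 < \<theta>1" "\<theta>1 < 1" "\<theta>0 \<noteq> \<theta>1" "0 < p" "0 < q" for \<theta>0 \<theta>1 p q :: real
  proof (cases "\<theta>0 < \<theta>1")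
    case True
    with that show ?thesis by (intro interpolation_spaces_differ assms(2))
  next
    case False
    with that show ?thesis by (intro interpolation_spaces_differ[symmetric] assms(2)) auto
  qed
  show ?thesis
  proof (intro conjI allI impI disjI1)
    fix \<theta> p :: real assume "0 < \<theta> \<and> \<theta> < 1 \<and> \<theta> \<noteq> 1/2 \<and> 0 < p"
    then show "interpolation_space A0 N0 A1 N1 \<theta> p \<noteq> interpolation_space A0 N0 A1 N1 (1 - \<theta>) p"
      by (intro differ) auto
    show "interpolation_space A0 N0 A1 N1 (1 - \<theta>) p = interpolation_space A1 N1 A0 N0 \<theta> p"
      by (rule interpolation_space_swap[symmetric])
  next
    fix \<theta>0 \<theta>1 p q :: real
    assume "0 < \<theta>0 \<and> \<theta>0 < 1 \<and> 0 < \<theta>1 \<and> \<theta>1 < 1 \<and> \<theta>0 \<noteq> \<theta>1 \<and> 0 < p \<and> 0 < q"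
    then show "interpolation_space A0 N0 A1 N1 \<theta>0 p \<noteq> interpolation_space A0 N0 A1 N1 \<theta>1 q"
      by (intro differ) auto
  qed
qed

end
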